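(* Let $\lambda_1,\lambda_2,\lambda_3$ be three complex numbers. For $f_1,f_2,f_3\in\mathcal C^\infty(S)$ let $$T(f_1,f_2,f_3)=\Big(\mathcal F_{-\lambda_3,\,\lambda_1-\lambda_2}\,P_{\lambda_1,\lambda_2}(f_1\otimes f_2),\,f_3\Big).$$ Then for any $g\in G$, $$T(\pi_{\lambda_1}(g)f_1,\pi_{\lambda_2}(g)f_2,\pi_{\lambda_3}(g)f_3)=T(f_1,f_2,f_3),$$ whenever the right-hand side is well defined.
   Context: Let $n\ge 3$, $S=\{x\in\mathbb R^n:|x|=1\}$, $\rho=\frac{n-1}{2}$, $d\sigma$ the Lebesgue (Euclidean surface) measure on $S$, ${\bf 1^{\pm}}=(\pm1,0,\dots,0)\in S$. Let $q(x)=x_0^2-(x_1^2+\dots+x_n^2)$ on $\mathbb R^{1,n}=\mathbb R^{n+1}$ and let $G=SO_0(1,n)$ be the identity component of the group $SO(1,n)$ of $q$. For $x\in S$ put $\widetilde x=(1,x_1,\dots,x_n)$. For $g\in G$, $x\in S$ put $\kappa(g,x)=\big((g\widetilde x)_0\big)^{-1}$, and let $g(x)\in S$ be the unique point with $\widetilde{g(x)}=\kappa(g,x)\,g\widetilde x$. For $\lambda\in\mathbb C$ the representation $\pi_\lambda$ of $G$ on $\mathcal C^\infty(S)$ is $\pi_\lambda(g)f(x)=\kappa(g^{-1},x)^{\rho+\lambda}f(g^{-1}(x))$; the same formula is used for functions with singularities. Let $H$ be the stabilizer of $({\bf 1^+},{\bf 1^-})$ in $G$ (acting diagonally on $S\times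 S$); its elements are $$h=\begin{pmatrix}\cosh t&\sinh t&0\\ \sinh t&\cosh t&0\\0&0&k\end{pmatrix},\quad t\in\mathbb R,\ k\in SO(n-1),$$ and for $\zeta\in\mathbb C$ put $\nu_\zeta(h)=e^{t\zeta}$. Let $\mathcal L_\zeta$ be the space of $\mathcal C^\infty$ functions $F:G\to\mathbb C$ with $F(gh)=\nu_\zeta(h)^{-1}F(g)$ for $g\in G$, $h\in H$. The map $gH\mapsto(g({\bf 1^+}),g({\bf 1^-}))$ identifies $G/H$ with $\{(s,t)\in S\times S:s\ne t\}$, and $\mu$ is the $G$-invariant measure on $G/H$ given there by $|s-t|^{-2(n-1)}d\sigma(s)\,d\sigma(t)$. For $\sigma,\tau\in\mathbb C$ and $f\in\mathcal C^\infty(S\times S)$, $P_{\sigma,\tau}f\in\mathcal L_{\sigma-\tau}$ is $$(P_{\sigma,\tau}f)(g)=\kappa(g,{\bf 1^+})^{\rho+\sigma}\kappa(g,{\bf 1^-})^{\rho+\tau}f\big(g({\bf 1^+}),g({\bf 1^-})\big).$$ For $\lambda,\zeta\in\mathbb C$ put $$\Theta_{\lambda,\zeta}(s)=|{\bf 1^+}-s|^{-\rho-\lambda+\zeta}\,|{\bf 1^-}-s|^{-\rho-\lambda-\zeta},$$ which satisfies $\pi_\lambda(h)\Theta_{\lambda,\zeta}=\nu_\zeta(h)\Theta_{\lambda,\zeta}$ for $h\in H$. For $F\in\mathcal L_\zeta$ put $$\mathcal F_{\lambda,\zeta}F(s)=\int_{G/H}F(g)\,\big(\pi_\lambda(g)\Theta_{\lambda,\zeta}\big)(s)\,d\mu(gH)$$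 (the integrand is right $H$-invariant in $g$). Finally $(u,v)=\int_S u(s)v(s)\,d\sigma(s)$ and $(f_1\otimes f_2)(x_1,x_2)=f_1(x_1)f_2(x_2)$. Thus $T(f_1,f_2,f_3)$ is an integral over $G/H\times S$, and it is well defined when this integral converges absolutely. *)

theory Defs
  imports "HOL-Analysis.Analysis"
begin

section \<open>The Lorentz group and its action on the sphere\<close>

text \<open>
  Points of \<open>\<real>\<^sup>n\<close>, vectors of \<open>\<real>\<^bsup>1,n\<^esup>\<close> and matrices acting on the latter.  The index \<^const>\<open>None\<close> is
  the coordinate \<open>x\<^sub>0\<close>.  The linear order on \<open>'n\<close> serves only to single out the first coordinate
  of \<open>\<real>\<^sup>n\<close>.
\<close>

type_synonym 'n pt = "(real, 'n) vec"
type_synonym 'n lvec = "(real, 'n option) vec"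
type_synonym 'n lmat = "((real, 'n option) vec, 'n option) vec"

definition rho :: "'n::finite itself \<Rightarrow> real" where
  "rho _ = (real CARD('n) - 1) / 2"

definition one_plus :: "'n::{finite,linorder} pt" where
  "one_plus = axis (Min UNIV) 1"

definition one_minus :: "'n::{finite,linorder} pt" where
  "one_minus = axis (Min UNIV) (-1)"

definition lorentz_form :: "'n::finite lvec \<Rightarrow> real" where
  "lorentz_form x = (x $ None)\<^sup>2 - (\<Sum>i\<in>UNIV. (x $ Some i)\<^sup>2)"

definition SO1 :: "'n::finite lmat set" where
  "SO1 = {A. (\<forall>x. lorentz_form (A *v x) = lorentz_form x) \<and> det A = 1}"

definition SO1_0 :: "'n::finite lmat set" where
  "SO1_0 = connected_component_set SO1 (mat 1)"

definition lift :: "'n::finite pt \<Rightarrow> 'n lvec" where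
  "lift x = (\<chi> i. case i of None \<Rightarrow> 1 | Some j \<Rightarrow> x $ j)"

definition kappa :: "'n::finite lmat \<Rightarrow> 'n pt \<Rightarrow> real" where
  "kappa g x = inverse ((g *v lift x) $ None)"

definition act :: "'n::finite lmat \<Rightarrow> 'n pt \<Rightarrow> 'n pt" where
  "act g x = (THE y. y \<in> sphere 0 1 \<and> lift y = kappa g x *\<^sub>R (g *v lift x))"


section \<open>Smooth functions on the sphere\<close>

primrec Ck_on :: "nat \<Rightarrow> ('a::real_normed_vector \<Rightarrow> 'b::real_normed_vector) \<Rightarrow> 'a set \<Rightarrow> bool" where
  "Ck_on 0 f U \<longleftrightarrow> continuous_on U f"
| "Ck_on (Suc k) f U \<longleftrightarrow>
     f differentiable_on U \<and> (\<forall>v. Ck_on k (\<lambda>x. frechet_derivative f (at x) v) U)"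

text \<open>
  Functions on the sphere are represented by functions on the ambient space, of which only the
  values on the sphere matter.
\<close>

definition smooth_on_sphere :: "('n::finite pt \<Rightarrow> complex) \<Rightarrow> bool" where
  "smooth_on_sphere f \<longleftrightarrow>
     (\<forall>x\<in>sphere 0 1. \<exists>U F. open U \<and> x \<in> U \<and> (\<forall>k. Ck_on k F U) \<and>
        (\<forall>y\<in>U \<inter> sphere 0 1. F y = f y))"


section \<open>Measures\<close>

text \<open>
  Euclidean surface measure on the unit sphere, in the normalisation \<open>dx = r\<^bsup>n-1\<^esup> dr d\<sigma>\<close>: the measure
  of \<open>A\<close> is \<open>n\<close> times the volume of the cone \<open>{r x | x \<in> A, 0 < r \<le> 1}\<close>.
\<close>

definition surface_measure :: "('n::finite pt) measure" where
  "surface_measure = scale_measure (of_nat CARD('n))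
     (distr (restrict_space lborel {x. 0 < norm x \<and> norm x \<le> 1})
            (restrict_space borel (sphere 0 1)) (\<lambda>x. x /\<^sub>R norm x))"

definition H_stab :: "('n::{finite,linorder} lmat) set" where
  "H_stab = {h \<in> SO1_0. act h one_plus = one_plus \<and> act h one_minus = one_minus}"

definition G_mod_H :: "('n::{finite,linorder} lmat) set set" where
  "G_mod_H = (\<lambda>g. (\<lambda>h. g ** h) ` H_stab) ` SO1_0"

definition coset_rep ::
    "'n::finite lmat set \<Rightarrow> 'n lmat" where
  "coset_rep C = (SOME g. g \<in> C)"

definition coset_pair ::
    "('n::{finite,linorder} lmat) set \<Rightarrow> ('n pt) \<times> ('n pt)" where
  "coset_pair C = (act (coset_rep C) one_plus, act (coset_rep C) one_minus)"

definition offdiag_measure :: "(('n::finite pt) \<times> ('n pt)) measure" where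
  "offdiag_measure =
     density (restrict_space (surface_measure \<Otimes>\<^sub>M surface_measure) {(s, t). s \<noteq> t})
       (\<lambda>(s, t). ennreal (norm (s - t) powr (- 2 * (real CARD('n) - 1))))"

text \<open>
  The measure \<open>\<mu>\<close> on \<open>G/H\<close> is the transport of the preceding one along the inverse of the bijection
  \<open>gH \<mapsto> (g(1\<^sup>+), g(1\<^sup>-))\<close>.
\<close>

definition mu :: "('n::{finite,linorder} lmat) set measure" where
  "mu = embed_measure offdiag_measure (inv_into G_mod_H coset_pair)"


section \<open>The representations and the trilinear form\<close>

definition pi_rep :: "complex \<Rightarrow> 'n::finite lmat \<Rightarrow>
    ('n pt \<Rightarrow> complex) \<Rightarrow> 'n pt \<Rightarrow> complex" where
  "pi_rep l g f x =
     complex_of_real (kappa (matrix_inv g) x) powr (complex_of_real (rho TYPE('n)) + l)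
       * f (act (matrix_inv g) x)"

definition P_op :: "complex \<Rightarrow> complex \<Rightarrow> (('n::{finite,linorder} pt) \<times> ('n pt) \<Rightarrow> complex) \<Rightarrow>
    'n lmat \<Rightarrow> complex" where
  "P_op a b f g =
     complex_of_real (kappa g one_plus) powr (complex_of_real (rho TYPE('n)) + a)
       * complex_of_real (kappa g one_minus) powr (complex_of_real (rho TYPE('n)) + b)
       * f (act g one_plus, act g one_minus)"

definition Theta :: "complex \<Rightarrow> complex \<Rightarrow> 'n::{finite,linorder} pt \<Rightarrow> complex" where
  "Theta l z s =
     complex_of_real (norm (one_plus - s)) powr (- complex_of_real (rho TYPE('n)) - l + z)
       * complex_of_real (norm (one_minus - s)) powr (- complex_of_real (rho TYPE('n)) - l - z)"

text \<open>
  The transform is applied to functions with \<open>F(gh) = e\<^bsup>-t\<zeta>\<^esup> F(g)\<close> for \<open>h\<close> in \<open>H\<close>, where \<open>t\<close> is the boost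
  parameter of \<open>h\<close>; \<^term>\<open>P_op a b f\<close> is one, with \<open>\<zeta> = a - b\<close>.  For such \<open>F\<close> the integrand is right
  \<open>H\<close>-invariant, so that the choice of a representative of the coset is irrelevant.
\<close>

definition F_integrand :: "complex \<Rightarrow> complex \<Rightarrow>
    ('n::{finite,linorder} lmat \<Rightarrow> complex) \<Rightarrow>
    ('n lmat) set \<Rightarrow> 'n pt \<Rightarrow> complex" where
  "F_integrand l z F C s = F (coset_rep C) * pi_rep l (coset_rep C) (Theta l z) s"

definition F_op :: "complex \<Rightarrow> complex \<Rightarrow>
    ('n::{finite,linorder} lmat \<Rightarrow> complex) \<Rightarrow> 'n pt \<Rightarrow> complex" where
  "F_op l z F s = (LINT C|mu. F_integrand l z F C s)"

definition pairing :: "('n::finite pt \<Rightarrow> complex) \<Rightarrow> ('n pt \<Rightarrow> complex) \<Rightarrow> complex" where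
  "pairing u v = (LINT s|surface_measure. u s * v s)"

definition tensor :: "('a \<Rightarrow> complex) \<Rightarrow> ('b \<Rightarrow> complex) \<Rightarrow> 'a \<times> 'b \<Rightarrow> complex" where
  "tensor f1 f2 = (\<lambda>(x1, x2). f1 x1 * f2 x2)"

definition T_form :: "complex \<Rightarrow> complex \<Rightarrow> complex \<Rightarrow> ('n::{finite,linorder} pt \<Rightarrow> complex) \<Rightarrow>
    ('n pt \<Rightarrow> complex) \<Rightarrow> ('n pt \<Rightarrow> complex) \<Rightarrow> complex" where
  "T_form l1 l2 l3 f1 f2 f3 =
     pairing (F_op (- l3) (l1 - l2) (P_op l1 l2 (tensor f1 f2))) f3"

definition T_well_defined :: "complex \<Rightarrow> complex \<Rightarrow> complex \<Rightarrow>
    ('n::{finite,linorder} pt \<Rightarrow> complex) \<Rightarrow>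
    ('n pt \<Rightarrow> complex) \<Rightarrow> ('n pt \<Rightarrow> complex) \<Rightarrow> bool" where
  "T_well_defined l1 l2 l3 f1 f2 f3 \<longleftrightarrow>
     integrable (mu \<Otimes>\<^sub>M surface_measure)
       (\<lambda>(C, s). F_integrand (- l3) (l1 - l2) (P_op l1 l2 (tensor f1 f2)) C s * f3 s)"

end

theory Submission
  imports Defs
begin

text \<open>
  The form \<open>T\<close> is the integral of an explicit kernel in three points of the sphere.  Apart from the
  values of \<open>f\<^sub>1\<close> and \<open>f\<^sub>2\<close>, all factors in \<open>F(g) (\<pi>(g)\<Theta>)(s)\<close> are powers of \<open>\<kappa>\<close> and of distances,
  and distances obey the conformal law
  \<open>|g(u) - g(v)|\<^sup>2 = \<kappa>(g,u) \<kappa>(g,v) |u - v|\<^sup>2\<close>.  With \<open>x = g(1\<^sup>+)\<close>, \<open>y = g(1\<^sup>-)\<close> and \<open>s = g(s')\<close> the powers of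
  \<open>\<kappa>\<close> combine so that the integrand becomes
  \<open>(|x - y|/2)\<^sup>a |x - s|\<^sup>b |y - s|\<^sup>c f\<^sub>1(x) f\<^sub>2(y) f\<^sub>3(s)\<close>, where \<open>a = 3\<rho> + \<lambda>\<^sub>1 + \<lambda>\<^sub>2 - \<lambda>\<^sub>3\<close>,
  \<open>b = -\<rho> + \<lambda>\<^sub>3 + \<lambda>\<^sub>1 - \<lambda>\<^sub>2\<close> and \<open>c = -\<rho> + \<lambda>\<^sub>3 - \<lambda>\<^sub>1 + \<lambda>\<^sub>2\<close>
  (lemma \<open>integrand_eq_kernel\<close>), to be integrated against \<open>|x - y|\<^bsup>-2(n-1)\<^esup> d\<sigma>(x) d\<sigma>(y) d\<sigma>(s)\<close>.  By the same law,
  replacing each \<open>f\<^sub>i\<close> by \<open>\<pi>(g)f\<^sub>i\<close> amounts to moving the three points by \<open>h = g\<^sup>-\<^sup>1\<close> and multiplying by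
  \<open>\<kappa>(h,s)\<^bsup>n-1\<^esup>\<close> (lemma \<open>kernel_pi_rep\<close>).  This factor is the Jacobian of \<open>h\<close> at \<open>s\<close>; the Jacobians at \<open>x\<close>
  and \<open>y\<close> are absorbed by the weight \<open>|x - y|\<^bsup>-2(n-1)\<^esup>\<close>.  Hence everything rests on the statement that \<open>h\<close>
  transforms \<open>\<sigma>\<close> with the density \<open>\<kappa>(h,\<cdot>)\<^bsup>n-1\<^esup>\<close> (theorem \<open>surface_measure_quasi_invariant\<close>).

  To prove it, identify \<open>\<real>\<^sup>n\<close> with the forward light cone by \<open>x \<mapsto> (|x|, x)\<close>.  A Lorentz matrix that keeps
  this cone acts on \<open>\<real>\<^sup>n\<close> by a map \<open>\<Phi>\<close>, homogeneous of degree one, which preserves the measure \<open>dx / |x|\<close>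
  (theorem \<open>cone_measure_invariant\<close>).  It is enough to check this for rotations and for reflections in
  spacelike vectors, because one reflection moves the image of the time axis back to the time axis; and
  a reflection shifts each point along one fixed direction, so that its derivative is a rank one
  perturbation of the identity.  The passage from the cone to the sphere is a radial averaging argument
  (lemma \<open>radial_average\<close>).

  The domain of integration \<open>G/H\<close> is turned into pairs of distinct points of the sphere, which requires
  that \<open>G\<close> act transitively on them (lemma \<open>transitive_on_pairs\<close>).  Reflections serve once more: two of
  them suffice to move the base pair to any other, and their product lies in the identity component because
  the spacelike vectors form a connected set.
\<close>

section \<open>Change of variables for rank one perturbations and orthogonal maps\<close>

text \<open>
  The change of variables theorem concerns well-ordered coordinates.  A finite linear order is
  well-founded, so a copy of the index type can be made a well-order, and results are pulled back along
  the relabelling of coordinates.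
\<close>

typedef 'a ranked = "UNIV :: 'a set" morphisms unrank Rank by simp

instance ranked :: (finite) finite
proof
  have "finite (Rank ` (UNIV :: 'a set))" by (rule finite_imageI) (rule finite)
  then show "finite (UNIV :: 'a ranked set)"
    by (simp add: type_definition.Abs_image[OF type_definition_ranked])
qed

instantiation ranked :: ("{finite,linorder}") wellorder
begin
definition less_eq_ranked :: "'a ranked \<Rightarrow> 'a ranked \<Rightarrow> bool" where
  "x \<le> y \<longleftrightarrow> unrank x \<le> unrank y"
definition less_ranked :: "'a ranked \<Rightarrow> 'a ranked \<Rightarrow> bool" where
  "x < y \<longleftrightarrow> unrank x < unrank y"
instance
proof
  fix x y z :: "'a ranked"
  show "(x < y) = (x \<le> y \<and> \<not> y \<le> x)" "x \<le> x" "x \<le> y \<or> y \<le> x"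
    by (auto simp: less_eq_ranked_def less_ranked_def)
  show "x \<le> y \<Longrightarrow> y \<le> z \<Longrightarrow> x \<le> z" "x \<le> y \<Longrightarrow> y \<le> x \<Longrightarrow> x = y"
    by (auto simp: less_eq_ranked_def unrank_inject[symmetric])
next
  fix P :: "'a ranked \<Rightarrow> bool" and a
  assume step: "\<And>x. (\<And>y. y < x \<Longrightarrow> P y) \<Longrightarrow> P x"
  have mono: "{z. z < unrank y} \<subset> {z. z < unrank x}" if "y < x" for x y :: "'a ranked"
    using that by (auto simp: less_ranked_def)
  show "P a"
  proof (induction "card {z. z < unrank a}" arbitrary: a rule: less_induct)
    case less
    show ?case
      by (rule step, rule less) (intro psubset_card_mono mono; simp)
  qed
qed
end

lemma bij_unrank: "bij unrank"
  by (metis bijI' type_definition.Rep_inject type_definition_ranked type_definition.Rep_range UNIV_I rangeE)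

lemma prod_Basis_vec:
  "(\<Prod>b\<in>Basis. (f::real^'n) \<bullet> b) = (\<Prod>i\<in>UNIV. f $ i)"
proof -
  have B: "(Basis :: (real^'n) set) = (\<lambda>i. axis i 1) ` UNIV"
    by (auto simp: Basis_vec_def)
  show ?thesis unfolding B
    by (subst prod.reindex) (auto simp: inj_on_def axis_eq_axis inner_axis)
qed

lemma lborel_distr_reindex:
  fixes \<pi> :: "'b::finite \<Rightarrow> 'a::finite"
  assumes "bij \<pi>"
  shows "distr lborel borel (\<lambda>x::real^'a. \<chi> i. x $ \<pi> i) = (lborel :: (real^'b) measure)"
proof (rule lborel_eqI[symmetric])
  fix l u :: "real^'b"
  assume "\<And>b. b \<in> Basis \<Longrightarrow> l \<bullet> b \<le> u \<bullet> b"
  from this[of "axis i 1" for i] have le: "l $ i \<le> u $ i" for i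
    by (auto simp: Basis_vec_def inner_axis)
  define l' u' where "l' = (\<chi> j. l $ inv \<pi> j)" and "u' = (\<chi> j. u $ inv \<pi> j)"
  have m: "(\<lambda>x::real^'a. \<chi> i. x $ \<pi> i) \<in> borel_measurable borel"
    by (intro borel_measurable_continuous_onI continuous_intros)
  have inv: "inv \<pi> (\<pi> i) = i" "\<pi> (inv \<pi> j) = j" for i j
    using assms by (auto simp: bij_def surj_f_inv_f)
  have "(\<lambda>x::real^'a. \<chi> i. x $ \<pi> i) -` box l u = box l' u'"
    by (auto simp: mem_box_cart l'_def u'_def) (metis inv)+
  then have "emeasure (distr lborel borel (\<lambda>x::real^'a. \<chi> i. x $ \<pi> i)) (box l u) = emeasure lborel (box l' u')"
    using m by (subst emeasure_distr) auto
  also have "\<dots> = (\<Prod>b\<in>Basis. (u' - l') \<bullet> b)"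
    using le by (subst emeasure_lborel_box_eq)
      (auto simp: Basis_vec_def inner_axis l'_def u'_def)
  also have "\<dots> = (\<Prod>j\<in>UNIV. (u' - l') $ j)"
    by (simp only: prod_Basis_vec)
  also have "\<dots> = (\<Prod>i\<in>UNIV. (u - l) $ i)"
    using assms by (subst prod.reindex_bij_betw[symmetric, of \<pi> UNIV]) (auto simp: l'_def u'_def inv)
  also have "\<dots> = (\<Prod>b\<in>Basis. (u - l) \<bullet> b)"
    by (simp only: prod_Basis_vec)
  finally show "emeasure (distr lborel borel (\<lambda>x::real^'a. \<chi> i. x $ \<pi> i)) (box l u)
     = (\<Prod>b\<in>Basis. (u - l) \<bullet> b)" .
qed simp

text \<open>
  Rotate \<open>a\<close> into a coordinate axis: then the matrix differs from the identity in one row only, and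
  Cramer's rule evaluates the determinant.
\<close>

lemma det_id_plus_rank_one:
  fixes a w :: "real^'n"
  shows "det (matrix (\<lambda>v. v + (w \<bullet> v) *\<^sub>R a)) = 1 + w \<bullet> a"
proof -
  obtain k :: 'n where True by blast
  obtain T where T: "orthogonal_transformation T" and Ta: "T (norm a *\<^sub>R axis k (1::real)) = a"
    using rotation_rightward_line[of a k] by metis
  note a = Ta[symmetric]
  define e where "e = (axis k 1 :: real^'n)"
  define S where "S = inv T"
  define u where "u = S w"
  have S: "orthogonal_transformation S" 
    unfolding S_def by (rule orthogonal_transformation_inv[OF T])
  have TS: "T (S x) = x" for x
    unfolding S_def using orthogonal_transformation_surj[OF T] by (simp add: surj_f_inv_f)
  have lin: "linear T" "linear S"
    using T S by (auto simp: orthogonal_transformation_linear)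
  let ?f = "\<lambda>v. v + (u \<bullet> v) *\<^sub>R (norm a *\<^sub>R e)"
  have linf: "linear ?f"
    by (intro linearI) (auto simp: algebra_simps)
  have eq: "(\<lambda>v. v + (w \<bullet> v) *\<^sub>R a) = T \<circ> (?f \<circ> S)"
  proof
    fix v
    have "u \<bullet> S v = w \<bullet> v"
      using S by (simp add: u_def orthogonal_transformation_def)
    moreover have "T (norm a *\<^sub>R e) = a" using a by (simp add: e_def)
    moreover have "(T \<circ> (?f \<circ> S)) v = T (S v) + (u \<bullet> S v) *\<^sub>R T (norm a *\<^sub>R e)"
      by (simp only: o_apply linear_add[OF lin(1)] linear_cmul[OF lin(1)])
    ultimately show "v + (w \<bullet> v) *\<^sub>R a = (T \<circ> (?f \<circ> S)) v"
      by (simp only: TS)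
  qed
  have TSid: "matrix T ** matrix S = mat 1"
  proof -
    have "T \<circ> S = id" using TS by auto
    then show ?thesis
      by (simp only: matrix_compose[OF lin(2,1), symmetric] matrix_id_mat_1)
  qed
  define x where "x = e + norm a *\<^sub>R u"
  have mf: "matrix ?f = (\<chi> i. if i = k then (\<Sum>i\<in>UNIV. x $ i *s row i (mat 1 :: real^'n^'n)) else row i (mat 1))"
  proof -
    have "(\<Sum>i\<in>UNIV. x $ i *s row i (mat 1 :: real^'n^'n)) = x"
      by (simp add: vec_eq_iff row_def mat_def if_distrib cong: if_cong)
    moreover have "matrix ?f $ i $ j = (if i = k then x $ j else mat 1 $ i $ j)" for i j
      by (simp add: matrix_def inner_axis x_def e_def) (simp add: axis_def mat_def)
    ultimately show ?thesis
      by (simp add: vec_eq_iff row_def)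
  qed
  have "det (matrix (\<lambda>v. v + (w \<bullet> v) *\<^sub>R a)) = det (matrix T) * (det (matrix ?f) * det (matrix S))"
    unfolding eq using lin linf linear_compose[OF lin(2) linf]
    by (simp add: matrix_compose det_mul)
  also have "\<dots> = det (matrix ?f) * det (matrix T ** matrix S)"
    by (simp add: det_mul)
  also have "\<dots> = det (matrix ?f)" by (simp add: TSid)
  also have "\<dots> = x $ k" unfolding mf cramer_lemma_transpose by simp
  also have "\<dots> = 1 + u \<bullet> (norm a *\<^sub>R e)"
    by (simp add: x_def e_def inner_axis)
  also have "\<dots> = 1 + w \<bullet> a"
  proof -
    have "T u \<bullet> T (norm a *\<^sub>R e) = u \<bullet> (norm a *\<^sub>R e)"
      using T unfolding orthogonal_transformation_def by blast
    then show ?thesis using a by (simp add: u_def TS e_def)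
  qed
  finally show ?thesis .
qed

text \<open>
  The change of variables formula as an identity of measures, so that it applies at once to nonnegative
  integrands.  It suffices to compare both measures on boxes.
\<close>

lemma lborel_change_of_variables_wo:
  fixes f :: "real^'n::{finite,wellorder} \<Rightarrow> real^'n::_"
  assumes S: "S \<in> sets borel"
    and der: "\<And>x. x \<in> S \<Longrightarrow> (f has_derivative f' x) (at x within S)"
    and inj: "inj_on f S"
    and null: "- f ` S \<in> null_sets lebesgue"
    and f: "f \<in> borel_measurable borel" and J: "J \<in> borel_measurable borel"
    and Jf: "\<And>x. x \<in> S \<Longrightarrow> J x = \<bar>det (matrix (f' x))\<bar>"
  shows "lborel = distr (density lborel (\<lambda>x. ennreal (J x) * indicator S x)) borel f"
proof (rule lborel_eqI)
  fix l u :: "real^'n::{finite,wellorder}"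
  assume le: "\<And>b. b \<in> Basis \<Longrightarrow> l \<bullet> b \<le> u \<bullet> b"
  define D where "D = f -` box l u \<inter> S"
  have D: "D \<in> sets borel"
    unfolding D_def using measurable_sets[OF f, of "box l u"] S by auto
  have "f ` D = box l u - (box l u \<inter> - f ` S)"
    unfolding D_def by auto
  moreover have nl: "box l u \<inter> - f ` S \<in> null_sets lebesgue"
    using null by (intro null_set_Int1) (auto intro: null)
  ultimately have fD: "f ` D \<in> lmeasurable" "measure lebesgue (f ` D) = measure lebesgue (box l u)"
  proof -
    assume *: "f ` D = box l u - (box l u \<inter> - f ` S)"
    show "f ` D \<in> lmeasurable" unfolding *
      using nl by (intro fmeasurable_Diff lmeasurable_box null_setsD2)
    show "measure lebesgue (f ` D) = measure lebesgue (box l u)" unfolding *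
      using nl by (intro measure_Diff_null_set fmeasurableD lmeasurable_box)
  qed
  have "((\<lambda>x. \<bar>det (matrix (f' x))\<bar>) has_integral measure lebesgue (box l u)) D"
  proof (subst has_measure_differentiable_image[symmetric, of D f])
    show "D \<in> sets lebesgue" using D by simp
    show "(f has_derivative f' x) (at x within D)" if "x \<in> D" for x
      using der[of x] that by (auto simp: D_def intro: has_derivative_subset)
    show "inj_on f D" using inj by (auto simp: D_def inj_on_def)
  qed (use fD in auto)
  then have hi: "(J has_integral measure lebesgue (box l u)) D"
    by (rule has_integral_eq[rotated]) (auto simp: D_def Jf)
  have "emeasure (distr (density lborel (\<lambda>x. ennreal (J x) * indicator S x)) borel f) (box l u)
      = emeasure (density lborel (\<lambda>x. ennreal (J x) * indicator S x)) (f -` box l u)"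
    using f by (subst emeasure_distr) auto
  also have "\<dots> = (\<integral>\<^sup>+x. ennreal (J x) * indicator S x * indicator (f -` box l u) x \<partial>lborel)"
    using J S measurable_sets[OF f, of "box l u"] by (subst emeasure_density) auto
  also have "\<dots> = (\<integral>\<^sup>+x. ennreal (J x) * indicator D x \<partial>lborel)"
    by (intro nn_integral_cong) (auto simp: D_def indicator_def)
  also have "\<dots> = (\<integral>\<^sup>+x. ennreal (indicator D x * J x) \<partial>lborel)"
    by (intro nn_integral_cong) (auto simp: indicator_def)
  also have "\<dots> = ennreal (measure lebesgue (box l u))"
    by (rule nn_integral_has_integral_lebesgue[OF _ hi]) (auto simp: D_def Jf)
  also have "\<dots> = (\<Prod>b\<in>Basis. (u - l) \<bullet> b)"
    using le by simp
  finally show "emeasure (distr (density lborel (\<lambda>x. ennreal (J x) * indicator S x)) borel f) (box l u)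
     = (\<Prod>b\<in>Basis. (u - l) \<bullet> b)" .
qed simp

lemma lborel_orthogonal_wo:
  fixes f :: "real^'n::{finite,wellorder} \<Rightarrow> real^'n::_"
  assumes f: "orthogonal_transformation f"
  shows "lborel = distr lborel borel f"
proof -
  have lin: "linear f" using f by (rule orthogonal_transformation_linear)
  have m: "f \<in> borel_measurable borel"
    using lin by (intro borel_measurable_continuous_onI linear_continuous_on linear_conv_bounded_linear[THEN iffD1])
  have "lborel = distr (density lborel (\<lambda>x. ennreal 1 * indicator UNIV x)) borel f"
  proof (rule lborel_change_of_variables_wo)
    show "(f has_derivative f) (at x within UNIV)" for x
      using lin by (simp add: linear_imp_has_derivative)
    show "inj_on f UNIV" using f by (rule orthogonal_transformation_inj)
    show "- f ` UNIV \<in> null_sets lebesgue"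
      using orthogonal_transformation_surj[OF f] by simp
    show "1 = \<bar>det (matrix f)\<bar>" using f by (simp add: orthogonal_transformation_det)
  qed (use m in auto)
  then show ?thesis by (simp add: density_1)
qed

text \<open>
  The origin is left out because the maps of interest, built from the norm, are not differentiable
  there.
\<close>

lemma lborel_rank_one_wo:
  fixes l :: "real^'n::{finite,wellorder} \<Rightarrow> real"
  assumes der: "\<And>x. x \<noteq> 0 \<Longrightarrow> (l has_derivative (\<lambda>v. w x \<bullet> v)) (at x)"
    and inj: "inj_on (\<lambda>x. x + l x *\<^sub>R a) (- {0})"
    and surj: "- {0} \<subseteq> (\<lambda>x. x + l x *\<^sub>R a) ` (- {0})"
    and l: "l \<in> borel_measurable borel" and w: "w \<in> borel_measurable borel"
  shows "lborel = distr (density lborel (\<lambda>x. ennreal \<bar>1 + w x \<bullet> a\<bar>)) borel (\<lambda>x. x + l x *\<^sub>R a)"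
proof -
  let ?f = "\<lambda>x. x + l x *\<^sub>R a"
  have J: "(\<lambda>x. \<bar>1 + w x \<bullet> a\<bar>) \<in> borel_measurable borel" using w by measurable
  have f: "?f \<in> borel_measurable borel" using l by measurable
  have "lborel = distr (density lborel (\<lambda>x. ennreal \<bar>1 + w x \<bullet> a\<bar> * indicator (- {0}) x)) borel ?f"
  proof (rule lborel_change_of_variables_wo)
    show "(?f has_derivative (\<lambda>v. v + (w x \<bullet> v) *\<^sub>R a)) (at x within - {0})" if "x \<in> - {0}" for x
      using that by (auto intro!: derivative_eq_intros has_derivative_at_withinI[OF der])
    show "- ?f ` (- {0}) \<in> null_sets lebesgue"
    proof -
      have "- ?f ` (- {0}) \<subseteq> {0}" using surj by blast
      then have "- ?f ` (- {0}) = {} \<or> - ?f ` (- {0}) = {0}" by (rule subset_singletonD)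
      then show ?thesis by (auto simp: negligible_iff_null_sets[symmetric])
    qed
    show "\<bar>1 + w x \<bullet> a\<bar> = \<bar>det (matrix (\<lambda>v. v + (w x \<bullet> v) *\<^sub>R a))\<bar>" for x
      by (simp add: det_id_plus_rank_one)
  qed (use inj J f in auto)
  also have "density lborel (\<lambda>x. ennreal \<bar>1 + w x \<bullet> a\<bar> * indicator (- {0}) x)
     = density lborel (\<lambda>x. ennreal \<bar>1 + w x \<bullet> a\<bar>)"
  proof (rule density_cong)
    show "AE x in lborel. ennreal \<bar>1 + w x \<bullet> a\<bar> * indicator (- {0}) x = ennreal \<bar>1 + w x \<bullet> a\<bar>"
      using AE_lborel_singleton[of 0] by eventually_elim auto
  qed (use J in measurable)
  finally show ?thesis .
qed

definition rankify :: "real^'n \<Rightarrow> real^'n ranked" where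
  "rankify x = (\<chi> i. x $ unrank i)"

definition unrankify :: "real^'n ranked \<Rightarrow> real^'n" where
  "unrankify y = (\<chi> i. y $ Rank i)"

lemma unrankify_rankify [simp]: "unrankify (rankify x) = x"
  by (simp add: rankify_def unrankify_def vec_eq_iff Rank_inverse)

lemma rankify_unrankify [simp]: "rankify (unrankify x) = x"
  by (simp add: rankify_def unrankify_def vec_eq_iff unrank_inverse)

lemma linear_rankify: "linear rankify" and linear_unrankify: "linear unrankify"
  by (auto intro!: linearI simp: rankify_def unrankify_def vec_eq_iff)

lemma inner_rankify: "rankify x \<bullet> rankify y = x \<bullet> y"
  unfolding inner_vec_def rankify_def
  using sum.reindex_bij_betw[OF bij_unrank, of "\<lambda>i. x $ i \<bullet> y $ i"] by simp

lemma rankify_measurable [measurable]: "rankify \<in> borel_measurable borel"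
  and unrankify_measurable [measurable]: "unrankify \<in> borel_measurable borel"
  using linear_rankify linear_unrankify
  by (intro borel_measurable_continuous_onI linear_continuous_on linear_conv_bounded_linear[THEN iffD1]; simp)+

text \<open>
  If \<open>g\<close> is \<open>f\<close> in the relabelled coordinates, a change of variables formula for \<open>g\<close> yields one for \<open>f\<close>.
\<close>

lemma lborel_distr_transport:
  fixes f :: "real^'n::{finite,linorder} \<Rightarrow> real^'n::_"
  assumes g: "lborel = distr (density lborel (\<lambda>y. J (unrankify y))) borel g"
    and fg: "\<And>y. unrankify (g y) = f (unrankify y)"
    and [measurable]: "f \<in> borel_measurable borel" "g \<in> borel_measurable borel" "J \<in> borel_measurable borel"
  shows "lborel = distr (density lborel J) borel f"
proof -
  have "bij (Rank :: 'n::{finite,linorder} \<Rightarrow> 'n::_ ranked)"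
    by (metis Rank_inject UNIV_I bijI' Rank_cases)
  from lborel_distr_reindex[OF this]
  have u: "distr lborel borel (unrankify :: real^('n::{finite,linorder}) ranked \<Rightarrow> real^'n::_) = lborel"
    by (simp add: unrankify_def[abs_def])
  have "lborel = distr lborel borel (unrankify :: real^('n::{finite,linorder}) ranked \<Rightarrow> real^'n::_)" by (simp add: u)
  also have "\<dots> = distr (density lborel (\<lambda>y. J (unrankify y))) borel (\<lambda>y. unrankify (g y))"
    by (subst g, subst distr_distr) (auto simp: o_def)
  also have "\<dots> = distr (distr (density lborel (\<lambda>y. J (unrankify y))) borel unrankify) borel f"
    by (subst distr_distr) (auto simp: o_def fg)
  also have "distr (density lborel (\<lambda>y. J (unrankify y))) borel unrankify
      = density (distr lborel borel unrankify) J"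
    by (subst density_distr) auto
  finally show ?thesis by (simp add: u)
qed

lemma lborel_orthogonal:
  fixes f :: "real^'n::{finite,linorder} \<Rightarrow> real^'n::_"
  assumes f: "orthogonal_transformation f"
  shows "distr lborel borel f = lborel"
proof -
  let ?g = "\<lambda>y. rankify (f (unrankify y))"
  have lin: "linear f" using f by (rule orthogonal_transformation_linear)
  have m [measurable]: "f \<in> borel_measurable borel"
    using lin by (intro borel_measurable_continuous_onI linear_continuous_on linear_conv_bounded_linear[THEN iffD1])
  have inner: "unrankify x \<bullet> unrankify y = x \<bullet> y" for x y :: "real^('n::{finite,linorder}) ranked"
    using inner_rankify[of "unrankify x" "unrankify y"] by simp
  have "orthogonal_transformation ?g"
    unfolding orthogonal_transformation_def
    using linear_compose[OF linear_compose[OF linear_unrankify lin] linear_rankify] f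
    by (simp add: inner_rankify o_def orthogonal_transformation_def inner)
  from lborel_orthogonal_wo[OF this]
  have "lborel = distr (density lborel (\<lambda>x. 1)) borel f"
    by (intro lborel_distr_transport[where g = ?g]) (simp_all add: density_1)
  then show ?thesis by (simp add: density_1)
qed

lemma lborel_rank_one:
  fixes l :: "real^'n::{finite,linorder} \<Rightarrow> real"
  assumes der: "\<And>x. x \<noteq> 0 \<Longrightarrow> (l has_derivative (\<lambda>v. w x \<bullet> v)) (at x)"
    and inj: "inj_on (\<lambda>x. x + l x *\<^sub>R a) (- {0})"
    and surj: "- {0} \<subseteq> (\<lambda>x. x + l x *\<^sub>R a) ` (- {0})"
    and l: "l \<in> borel_measurable borel" and w: "w \<in> borel_measurable borel"
  shows "lborel = distr (density lborel (\<lambda>x. ennreal \<bar>1 + w x \<bullet> a\<bar>)) borel (\<lambda>x. x + l x *\<^sub>R a)"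
proof (rule lborel_distr_transport)
  note [measurable] = l w
  let ?g = "\<lambda>y. y + l (unrankify y) *\<^sub>R rankify a"
  have rw: "rankify x \<bullet> y = x \<bullet> unrankify y" for x :: "real^'n::{finite,linorder}" and y
    using inner_rankify[of x "unrankify y"] by simp
  have add: "rankify (x + c *\<^sub>R y) = rankify x + c *\<^sub>R rankify y" for x y :: "real^'n::{finite,linorder}" and c
    by (simp add: linear_add[OF linear_rankify] linear_cmul[OF linear_rankify])
  have z: "unrankify y = 0 \<longleftrightarrow> y = 0" for y :: "real^('n::{finite,linorder}) ranked"
    by (metis linear_0 linear_rankify linear_unrankify rankify_unrankify)
  have g: "?g y = rankify (unrankify y + l (unrankify y) *\<^sub>R a)" for y
    by (simp add: add)
  have "lborel = distr (density lborel (\<lambda>y. ennreal \<bar>1 + rankify (w (unrankify y)) \<bullet> rankify a\<bar>)) borel ?g"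
  proof (rule lborel_rank_one_wo)
    fix y :: "real^('n::{finite,linorder}) ranked" assume "y \<noteq> 0"
    then have "(l has_derivative (\<lambda>v. w (unrankify y) \<bullet> v)) (at (unrankify y))"
      by (intro der) (simp add: z)
    moreover have "(unrankify has_derivative unrankify) (at y)"
      by (intro linear_imp_has_derivative linear_unrankify)
    ultimately show "((\<lambda>y. l (unrankify y)) has_derivative (\<lambda>v. rankify (w (unrankify y)) \<bullet> v)) (at y)"
      using has_derivative_compose[of unrankify unrankify y UNIV l] by (simp add: rw)
  next
    show "inj_on ?g (- {0})"
    proof (rule inj_onI)
      fix x y :: "real^('n::{finite,linorder}) ranked" assume "x \<in> - {0}" "y \<in> - {0}" "?g x = ?g y"
      then have "unrankify (?g x) = unrankify (?g y)" by (simp only:)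
      then have "unrankify x + l (unrankify x) *\<^sub>R a = unrankify y + l (unrankify y) *\<^sub>R a"
        by (simp only: g unrankify_rankify)
      then have "unrankify x = unrankify y"
        by (rule inj_onD[OF inj]) (use z \<open>x \<in> - {0}\<close> \<open>y \<in> - {0}\<close> in auto)
      then show "x = y" by (metis rankify_unrankify)
    qed
    show "- {0} \<subseteq> ?g ` (- {0})"
    proof
      fix y :: "real^('n::{finite,linorder}) ranked" assume "y \<in> - {0}"
      then obtain x where x: "x \<noteq> 0" "unrankify y = x + l x *\<^sub>R a"
        using surj z[of y] by (force simp: subset_iff image_iff)
      have "?g (rankify x) = rankify (x + l x *\<^sub>R a)" by (simp add: add)
      then have "y = ?g (rankify x)" by (simp only: x(2)[symmetric] rankify_unrankify)
      moreover have "rankify x \<noteq> 0" using x(1) z[of "rankify x"] by simp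
      ultimately have "rankify x \<in> - {0} \<and> y = ?g (rankify x)" by simp
      then show "y \<in> ?g ` (- {0})" by blast
    qed
  qed measurable
  then show "lborel = distr (density lborel (\<lambda>y. ennreal \<bar>1 + w (unrankify y) \<bullet> a\<bar>)) borel ?g"
    by (simp add: inner_rankify)
  show "unrankify (?g y) = unrankify y + l (unrankify y) *\<^sub>R a" for y
    by (simp only: g unrankify_rankify)
qed (use l w in measurable)

section \<open>Minkowski form, forward light cone and Lorentz reflections\<close>

definition space_part :: "'n::finite lvec \<Rightarrow> 'n pt" where
  "space_part v = (\<chi> j. v $ Some j)"

definition mink :: "'n::finite lvec \<Rightarrow> 'n lvec \<Rightarrow> real" where
  "mink u v = u $ None * v $ None - space_part u \<bullet> space_part v"

text \<open>
  The parametrisation of the closed forward light cone by \<open>\<real>\<^sup>n\<close>.  On the sphere it is \<^const>\<open>lift\<close>.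
\<close>

definition null_lift :: "'n::finite pt \<Rightarrow> 'n lvec" where
  "null_lift x = (\<chi> i. case i of None \<Rightarrow> norm x | Some j \<Rightarrow> x $ j)"

text \<open>
  Both orientations are admitted, so that single reflections belong to this group.
\<close>

definition orthochronous :: "'n::finite lmat set" where
  "orthochronous = {A. (\<forall>v. lorentz_form (A *v v) = lorentz_form v) \<and>
     (\<forall>x. x \<noteq> 0 \<longrightarrow> 0 < (A *v null_lift x) $ None)}"

text \<open>
  The action on the forward light cone, read off in the parametrisation by \<open>\<real>\<^sup>n\<close>.
\<close>

definition cone_map :: "'n::finite lmat \<Rightarrow> 'n pt \<Rightarrow> 'n pt" where
  "cone_map A x = space_part (A *v null_lift x)"

lemma space_part_simps [simp]:
  "space_part (u + v) = space_part u + space_part v"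
  "space_part (u - v) = space_part u - space_part v"
  "space_part (c *\<^sub>R u) = c *\<^sub>R space_part u"
  "space_part 0 = 0"
  by (simp_all add: space_part_def vec_eq_iff)

lemma null_lift_simps [simp]: "null_lift x $ None = norm x" "null_lift x $ Some j = x $ j" "space_part (null_lift x) = x"
  by (simp_all add: null_lift_def space_part_def vec_eq_iff)

lemma lvec_eqI: "u $ None = v $ None \<Longrightarrow> space_part u = space_part v \<Longrightarrow> u = v"
  by (simp add: vec_eq_iff space_part_def) (metis option.exhaust)

definition space_embed :: "'n::finite pt \<Rightarrow> 'n lvec" where
  "space_embed x = (\<chi> i. case i of None \<Rightarrow> 0 | Some j \<Rightarrow> x $ j)"

lemma space_embed_simps [simp]: "space_embed x $ None = 0" "space_part (space_embed x) = x"
  by (simp_all add: space_embed_def space_part_def vec_eq_iff)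

lemma linear_space_embed: "linear space_embed"
  by (intro linearI lvec_eqI) auto

lemma mink_simps:
  "mink (u + v) w = mink u w + mink v w"
  "mink (u - v) w = mink u w - mink v w"
  "mink (c *\<^sub>R u) w = c * mink u w"
  "mink w (u + v) = mink w u + mink w v"
  "mink w (u - v) = mink w u - mink w v"
  "mink w (c *\<^sub>R u) = c * mink w u"
  by (simp_all add: mink_def inner_simps algebra_simps)

lemma mink_commute: "mink u v = mink v u"
  by (simp add: mink_def inner_commute mult.commute)

lemma lorentz_form_mink: "lorentz_form v = mink v v"
  by (simp add: lorentz_form_def mink_def inner_vec_def space_part_def power2_eq_square)

lemma mink_null_lift: "mink (null_lift x) (null_lift y) = norm x * norm y - x \<bullet> y"
  by (simp add: mink_def)

lemma mink_null_lift_self: "mink (null_lift x) (null_lift x) = 0"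
  by (simp add: mink_def power2_norm_eq_inner[symmetric] power2_eq_square)

lemma mink_preserved:
  fixes A :: "'n::finite lmat"
  assumes "\<forall>v. lorentz_form (A *v v) = lorentz_form v"
  shows "mink (A *v u) (A *v v) = mink u v"
proof -
  have "2 * mink x y = lorentz_form (x + y) - lorentz_form x - lorentz_form y" for x y :: "'n lvec"
    by (simp add: lorentz_form_mink mink_simps mink_commute)
  from this[of "A *v u" "A *v v"] this[of u v] show ?thesis
    using assms by (simp add: matrix_vector_right_distrib[symmetric])
qed

lemma null_lift_0 [simp]: "null_lift 0 = 0"
  by (rule lvec_eqI) auto

text \<open>
  The image of a null vector is null, so its time component is the norm of the space part up to sign,
  and the sign is positive.
\<close>

lemma orthochronous_null_lift:
  assumes "A \<in> orthochronous"
  shows "A *v null_lift x = null_lift (cone_map A x)"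
proof (cases "x = 0")
  case False
  have "mink (A *v null_lift x) (A *v null_lift x) = 0"
    using assms by (subst mink_preserved) (auto simp: orthochronous_def mink_null_lift_self)
  then have "((A *v null_lift x) $ None)\<^sup>2 = (norm (cone_map A x))\<^sup>2"
    by (simp add: mink_def cone_map_def dot_square_norm power2_eq_square)
  moreover have "0 < (A *v null_lift x) $ None"
    using assms False by (auto simp: orthochronous_def)
  ultimately have "(A *v null_lift x) $ None = norm (cone_map A x)"
    by (metis norm_ge_zero less_imp_le power2_eq_imp_eq)
  then show ?thesis by (intro lvec_eqI) (auto simp: cone_map_def)
qed (simp add: cone_map_def)

lemma cone_map_scale:
  assumes "0 \<le> t"
  shows "cone_map A (t *\<^sub>R x) = t *\<^sub>R cone_map A x"
proof -
  have "null_lift (t *\<^sub>R x) = t *\<^sub>R null_lift x"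
    using assms by (intro lvec_eqI) auto
  then show ?thesis by (simp add: cone_map_def matrix_vector_mult_scaleR)
qed

lemma cone_map_nonzero:
  assumes "A \<in> orthochronous" "x \<noteq> 0"
  shows "cone_map A x \<noteq> 0"
proof -
  have "0 < (A *v null_lift x) $ None" using assms by (auto simp: orthochronous_def)
  then show ?thesis unfolding orthochronous_null_lift[OF assms(1)] by auto
qed

lemma norm_cone_map: "A \<in> orthochronous \<Longrightarrow> norm (cone_map A x) = (A *v null_lift x) $ None"
  by (simp add: orthochronous_null_lift)

lemma cone_map_mult:
  assumes "B \<in> orthochronous"
  shows "cone_map (A ** B) x = cone_map A (cone_map B x)"
  unfolding cone_map_def[of "A ** B"] cone_map_def[of A]
  by (simp add: matrix_vector_mul_assoc[symmetric] orthochronous_null_lift[OF assms])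

lemma orthochronous_mult:
  assumes A: "A \<in> orthochronous" and B: "B \<in> orthochronous"
  shows "A ** B \<in> orthochronous"
proof -
  have "0 < ((A ** B) *v null_lift x) $ None" if "x \<noteq> 0" for x
    using A cone_map_nonzero[OF B that]
    by (simp add: matrix_vector_mul_assoc[symmetric] orthochronous_null_lift[OF B]) (simp add: orthochronous_def)
  then show ?thesis
    using A B by (simp add: orthochronous_def matrix_vector_mul_assoc[symmetric])
qed

lemma continuous_null_lift: "continuous_on UNIV (null_lift :: 'n::finite pt \<Rightarrow> _)"
  unfolding null_lift_def
proof (intro continuous_on_vec_lambda)
  show "continuous_on UNIV (\<lambda>x::'n pt. case i of None \<Rightarrow> norm x | Some j \<Rightarrow> x $ j)" for i
    by (cases i) (auto intro!: continuous_intros)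
qed

lemma space_part_linear: "bounded_linear space_part"
  by (intro linear_conv_bounded_linear[THEN iffD1] linearI) auto

lemma continuous_cone_map: "continuous_on UNIV (cone_map A)"
  unfolding cone_map_def
  by (intro bounded_linear.continuous_on[OF space_part_linear]
    bounded_linear.continuous_on[OF matrix_vector_mul_bounded_linear] continuous_null_lift)

lemma cone_map_measurable [measurable]: "cone_map A \<in> borel_measurable borel"
  by (intro borel_measurable_continuous_onI continuous_cone_map)

definition reflection :: "'n::finite lvec \<Rightarrow> 'n lmat" where
  "reflection a = matrix (\<lambda>v. v - (2 * mink v a / mink a a) *\<^sub>R a)"

lemma reflection_apply: "reflection a *v v = v - (2 * mink v a / mink a a) *\<^sub>R a"
proof -
  have "linear (\<lambda>v. v - (2 * mink v a / mink a a) *\<^sub>R a)"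
    by (intro linearI) (auto simp: mink_simps algebra_simps add_divide_distrib)
  then show ?thesis unfolding reflection_def by (rule fun_cong[OF matrix_vector_mul(2)])
qed

lemma lorentz_form_reflection:
  assumes "mink a a \<noteq> 0"
  shows "lorentz_form (reflection a *v v) = lorentz_form v"
  using assms
  by (simp add: lorentz_form_mink reflection_apply mink_simps mink_commute[of a v] field_simps power2_eq_square)

lemma reflection_involution:
  assumes "mink a a \<noteq> 0"
  shows "reflection a ** reflection a = mat 1"
proof -
  have "reflection a *v (reflection a *v v) = v" for v
  proof -
    have "mink (v - (2 * mink v a / mink a a) *\<^sub>R a) a = - mink v a"
      using assms by (simp add: mink_simps)
    then show ?thesis unfolding reflection_apply by simp
  qed
  then show ?thesis by (simp add: matrix_eq matrix_vector_mul_assoc[symmetric])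
qed

text \<open>
  With \<open>s\<close> the time component and \<open>b\<close> the norm of the space part of \<open>a\<close>, the time component of the
  image of the null vector over \<open>x\<close> is at least \<open>|x| (b - |s|)\<^sup>2 / (b\<^sup>2 - s\<^sup>2)\<close> by Cauchy-Schwarz.
\<close>

lemma reflection_orthochronous:
  assumes "mink a a < 0"
  shows "reflection a \<in> orthochronous"
proof -
  have "0 < (reflection a *v null_lift x) $ None" if "x \<noteq> 0" for x
  proof -
    define s where "s = a $ None"
    define b where "b = norm (space_part a)"
    define p where "p = x \<bullet> space_part a"
    have Q: "mink a a = s\<^sup>2 - b\<^sup>2"
      by (simp add: mink_def s_def b_def dot_square_norm power2_eq_square)
    have sb: "s\<^sup>2 < b\<^sup>2" using assms Q by simp
    have "0 \<le> b" by (simp add: b_def)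
    then have lt: "\<bar>s\<bar> < b" using sb by (metis abs_le_square_iff abs_of_nonneg not_le)
    have "p * s \<le> \<bar>p\<bar> * \<bar>s\<bar>" by (metis abs_ge_self abs_mult)
    also have "\<dots> \<le> (norm x * b) * \<bar>s\<bar>"
      by (intro mult_right_mono) (auto simp: p_def b_def Cauchy_Schwarz_ineq2)
    finally have "p * s \<le> (norm x * b) * \<bar>s\<bar>" .
    moreover have "0 < norm x * (b - \<bar>s\<bar>)\<^sup>2" using that lt by simp
    ultimately have "0 < norm x * (b\<^sup>2 + s\<^sup>2) - 2 * (p * s)"
      by (simp add: power2_diff algebra_simps)
    moreover have "(reflection a *v null_lift x) $ None = (norm x * (b\<^sup>2 + s\<^sup>2) - 2 * (p * s)) / (b\<^sup>2 - s\<^sup>2)"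
      using sb unfolding reflection_apply Q
      by (simp add: mink_def s_def[symmetric] p_def[symmetric] field_simps power2_eq_square)
    ultimately show ?thesis using sb by simp
  qed
  then show ?thesis using assms by (simp add: orthochronous_def lorentz_form_reflection)
qed

section \<open>The invariant measure on the light cone\<close>

definition cone_measure :: "'n::finite pt measure" where
  "cone_measure = density lborel (\<lambda>x. ennreal (inverse (norm x)))"

lemma cone_measure_invariantI:
  fixes f :: "'n::finite pt \<Rightarrow> 'n pt"
  assumes f [measurable]: "f \<in> borel_measurable borel"
    and nz: "\<And>x. x \<noteq> 0 \<Longrightarrow> f x \<noteq> 0"
    and lb: "lborel = distr (density lborel (\<lambda>x. ennreal (norm (f x) / norm x))) borel f"
  shows "distr cone_measure borel f = cone_measure"
proof -
  have "(cone_measure :: 'n pt measure) =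
      density (distr (density lborel (\<lambda>x. ennreal (norm (f x) / norm x))) borel f) (\<lambda>x. ennreal (inverse (norm x)))"
    unfolding cone_measure_def by (subst lb) (rule refl)
  also have "\<dots> = distr (density (density lborel (\<lambda>x. ennreal (norm (f x) / norm x)))
      (\<lambda>x. ennreal (inverse (norm (f x))))) borel f"
    by (subst density_distr) auto
  also have "density (density lborel (\<lambda>x. ennreal (norm (f x) / norm x))) (\<lambda>x. ennreal (inverse (norm (f x))))
     = density lborel (\<lambda>x. ennreal (norm (f x) / norm x) * ennreal (inverse (norm (f x))))"
    by (subst density_density_eq) auto
  also have "\<dots> = cone_measure"
    unfolding cone_measure_def
  proof (rule density_cong)
    show "AE x in lborel. ennreal (norm (f x) / norm x) * ennreal (inverse (norm (f x))) = ennreal (inverse (norm x))"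
      using AE_lborel_singleton[of "0 :: 'n pt"]
      by eventually_elim (use nz in \<open>auto simp: ennreal_mult[symmetric] divide_inverse\<close>)
  qed measurable
  finally show ?thesis by simp
qed

text \<open>
  In the parametrisation by \<open>\<real>\<^sup>n\<close> the reflection is \<open>x \<mapsto> x + l(x) a'\<close> with \<open>a'\<close> the space part of \<open>a\<close>.  Its
  Jacobian \<open>1 + \<nabla>l(x) \<bullet> a'\<close> turns out to be \<open>-|\<Phi>(x)| / |x|\<close>, and the map is bijective because it is an involution.
\<close>

lemma cone_measure_reflection:
  fixes a :: "'n::{finite,linorder} lvec"
  assumes a: "mink a a < 0"
  shows "distr cone_measure borel (cone_map (reflection a)) = cone_measure"
proof (rule cone_measure_invariantI)
  let ?R = "reflection a" and ?a = "space_part a"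
  let ?f = "cone_map ?R"
  note R = reflection_orthochronous[OF a]
  define l where "l x = - (2 / mink a a) * (norm x * a $ None - x \<bullet> ?a)" for x
  define w where "w x = - (2 / mink a a) *\<^sub>R (a $ None *\<^sub>R sgn x - ?a)" for x
  have f: "?f x = x + l x *\<^sub>R ?a" for x
    by (simp add: cone_map_def reflection_apply l_def mink_def)
  have nf: "norm (?f x) = norm x + l x * a $ None" for x
    by (simp add: norm_cone_map[OF R] reflection_apply l_def mink_def)
  show nz: "\<And>x. x \<noteq> 0 \<Longrightarrow> ?f x \<noteq> 0" by (rule cone_map_nonzero[OF R])
  have inv: "?f (?f x) = x" for x
    using cone_map_mult[OF R, of ?R x] a by (simp add: reflection_involution) (simp add: cone_map_def)
  have "lborel = distr (density lborel (\<lambda>x. ennreal \<bar>1 + w x \<bullet> ?a\<bar>)) borel (\<lambda>x. x + l x *\<^sub>R ?a)"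
  proof (rule lborel_rank_one)
    fix x :: "'n pt" assume x: "x \<noteq> 0"
    have "((\<lambda>x. c * (norm x * a $ None - x \<bullet> ?a)) has_derivative
        (\<lambda>v. c * ((v \<bullet> sgn x) * a $ None - v \<bullet> ?a))) (at x)" for c
      using x by (auto intro!: derivative_eq_intros has_derivative_norm)
    then have "(l has_derivative (\<lambda>v. - (2 / mink a a) * ((v \<bullet> sgn x) * a $ None - v \<bullet> ?a))) (at x)"
      unfolding l_def[abs_def] .
    then show "(l has_derivative (\<lambda>v. w x \<bullet> v)) (at x)"
      by (simp add: w_def inner_simps inner_commute mult.commute)
  next
    show "inj_on (\<lambda>x. x + l x *\<^sub>R ?a) (- {0})"
      unfolding f[symmetric] by (metis inj_onI inv)
    show "- {0} \<subseteq> (\<lambda>x. x + l x *\<^sub>R ?a) ` (- {0})"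
    proof
      fix y :: "'n pt" assume "y \<in> - {0}"
      then have "?f y \<in> - {0}" using nz by simp
      moreover have "y = ?f y + l (?f y) *\<^sub>R ?a" by (simp only: f[symmetric] inv)
      ultimately show "y \<in> (\<lambda>x. x + l x *\<^sub>R ?a) ` (- {0})" by (rule rev_image_eqI)
    qed
    show "l \<in> borel_measurable borel" unfolding l_def by measurable
    show "w \<in> borel_measurable borel" unfolding w_def sgn_div_norm by measurable
  qed
  also have "density lborel (\<lambda>x. ennreal \<bar>1 + w x \<bullet> ?a\<bar>) = density lborel (\<lambda>x. ennreal (norm (?f x) / norm x))"
  proof (rule density_cong)
    show "AE x in lborel. ennreal \<bar>1 + w x \<bullet> ?a\<bar> = ennreal (norm (?f x) / norm x)"
      using AE_lborel_singleton[of "0 :: 'n pt"]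
    proof eventually_elim
      fix x :: "'n pt" assume x: "x \<noteq> 0"
      have Q: "mink a a = (a $ None)\<^sup>2 - ?a \<bullet> ?a" by (simp add: mink_def power2_eq_square)
      have "1 + w x \<bullet> ?a = - (norm (?f x) / norm x)"
        using x a unfolding nf l_def w_def sgn_div_norm
        by (simp add: inner_simps field_simps) (simp add: Q algebra_simps power2_eq_square)
      then show "ennreal \<bar>1 + w x \<bullet> ?a\<bar> = ennreal (norm (?f x) / norm x)" by simp
    qed
    show "(\<lambda>x. ennreal \<bar>1 + w x \<bullet> ?a\<bar>) \<in> borel_measurable lborel"
      unfolding w_def sgn_div_norm by measurable
  qed measurable
  finally show "lborel = distr (density lborel (\<lambda>x. ennreal (norm (?f x) / norm x))) borel ?f"
    unfolding f[symmetric] .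
qed measurable

definition time_axis :: "'n::finite lvec" where
  "time_axis = axis None 1"

lemma time_axis_simps [simp]: "time_axis $ None = 1" "space_part time_axis = 0"
  by (simp_all add: time_axis_def space_part_def vec_eq_iff axis_def)

text \<open>
  A matrix fixing the time axis preserves time components, hence norms on the cone, and is linear on
  the space components.
\<close>

lemma cone_measure_rotation:
  fixes k :: "'n::{finite,linorder} lmat"
  assumes k: "k \<in> orthochronous" and fix0: "k *v time_axis = time_axis"
  shows "distr cone_measure borel (cone_map k) = cone_measure"
proof (rule cone_measure_invariantI)
  have norm: "norm (cone_map k x) = norm x" for x
  proof -
    have "norm (cone_map k x) = mink (k *v null_lift x) (k *v time_axis)"
      unfolding fix0 by (simp add: norm_cone_map[OF k] mink_def)
    also have "\<dots> = norm x"
      using k by (subst mink_preserved) (auto simp: orthochronous_def, simp add: mink_def)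
    finally show ?thesis .
  qed
  have split: "null_lift x = norm x *\<^sub>R time_axis + space_embed x" for x :: "'n pt"
    by (rule lvec_eqI) simp_all
  have f: "cone_map k x = space_part (k *v space_embed x)" for x
    unfolding cone_map_def split
    by (simp add: matrix_vector_right_distrib matrix_vector_mult_scaleR fix0)
  have "linear (cone_map k)"
    unfolding f[abs_def]
    by (intro linearI) (simp_all add: linear_add[OF linear_space_embed] linear_cmul[OF linear_space_embed]
      matrix_vector_right_distrib matrix_vector_mult_scaleR)
  then have "orthogonal_transformation (cone_map k)"
    by (simp add: orthogonal_transformation norm)
  then have o: "distr lborel borel (cone_map k) = lborel" by (rule lborel_orthogonal)
  have "density lborel (\<lambda>x::'n pt. ennreal (norm (cone_map k x) / norm x)) = density lborel (\<lambda>_. 1)"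
    unfolding norm
    by (rule density_cong) (use AE_lborel_singleton[of "0 :: 'n pt"] in auto)
  then have d: "density lborel (\<lambda>x::'n pt. ennreal (norm (cone_map k x) / norm x)) = lborel"
    by (simp only: density_1)
  show "lborel = distr (density lborel (\<lambda>x. ennreal (norm (cone_map k x) / norm x))) borel (cone_map k)"
    unfolding d o ..
qed (use cone_map_nonzero[OF k] in auto)

text \<open>
  If \<open>v\<close> is the image of the time axis, then either \<open>v\<close> is the time axis itself or the reflection in their
  difference exchanges them; in the latter case that reflection turns \<open>A\<close> into a rotation.
\<close>

theorem cone_measure_invariant:
  fixes A :: "'n::{finite,linorder} lmat"
  assumes A: "A \<in> orthochronous"
  shows "distr cone_measure borel (cone_map A) = cone_measure"
proof -
  define v where "v = A *v time_axis"
  have pres: "mink (A *v x) (A *v y) = mink x y" for x y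
    using A by (intro mink_preserved) (auto simp: orthochronous_def)
  have vv: "(v $ None)\<^sup>2 = 1 + (norm (space_part v))\<^sup>2"
    using pres[of time_axis time_axis] 
    by (simp add: v_def[symmetric]) (simp add: mink_def power2_eq_square power2_norm_eq_inner[symmetric])
  \<comment> \<open>Twice the time axis is a sum of two forward null vectors.\<close>
  have v0: "0 < v $ None"
  proof -
    define x :: "'n pt" where "x = axis (Min UNIV) 1"
    have x: "norm x = 1" by (simp add: x_def)
    have "(2::real) *\<^sub>R time_axis = null_lift x + null_lift (- x)"
      by (rule lvec_eqI) (simp_all add: x)
    then have "2 *\<^sub>R v = A *v null_lift x + A *v null_lift (- x)"
      unfolding v_def by (simp add: matrix_vector_right_distrib[symmetric] matrix_vector_mult_scaleR[symmetric])
    then have "2 * v $ None = (A *v null_lift x) $ None + (A *v null_lift (- x)) $ None"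
      by (metis vector_add_component vector_scaleR_component real_scaleR_def)
    moreover have "x \<noteq> 0" using x by auto
    ultimately show ?thesis using A by (auto simp: orthochronous_def) (smt (verit) neg_equal_0_iff_equal)
  qed
  show ?thesis
  proof (cases "v = time_axis")
    case True
    then show ?thesis using A by (intro cone_measure_rotation) (auto simp: v_def)
  next
    case False
    define a where "a = time_axis - v"
    have "space_part v \<noteq> 0"
    proof
      assume "space_part v = 0"
      with vv v0 have "v $ None = 1" by (simp add: power2_eq_1_iff)
      with \<open>space_part v = 0\<close> False show False by (auto intro: lvec_eqI)
    qed
    then have v1: "1 < v $ None"
      using vv v0 by (metis abs_of_pos less_add_same_cancel1 one_power2 power2_less_imp_less less_imp_le zero_less_norm_iff zero_less_power)
    have mv: "mink v v = 1" using pres[of time_axis time_axis] by (simp add: v_def) (simp add: mink_def)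
    have tt: "mink time_axis time_axis = 1" and tv: "mink time_axis v = v $ None" "mink v time_axis = v $ None"
      by (simp_all add: mink_def)
    have aa: "mink a a = 2 - 2 * v $ None"
      by (simp add: a_def mink_simps mv tt tv)
    then have neg: "mink a a < 0" using v1 by simp
    define R where "R = reflection a"
    have R: "R \<in> orthochronous" unfolding R_def by (rule reflection_orthochronous[OF neg])
    have "mink v a = v $ None - 1" by (simp add: a_def mink_simps mv tv)
    then have "2 * mink v a / mink a a = -1" using v1 unfolding aa by (simp add: field_simps)
    then have Rv: "R *v v = time_axis" by (simp add: R_def reflection_apply a_def)
    define k where "k = R ** A"
    have k: "k \<in> orthochronous" unfolding k_def by (rule orthochronous_mult[OF R A])
    have "k *v time_axis = time_axis"
      by (simp add: k_def matrix_vector_mul_assoc[symmetric] v_def[symmetric] Rv)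
    note rot = cone_measure_rotation[OF k this]
    have "A = R ** k"
      using reflection_involution[of a] neg by (simp add: k_def matrix_mul_assoc R_def)
    then have "cone_map A = (\<lambda>x. cone_map R (cone_map k x))"
      using cone_map_mult[OF k] by auto
    then have "distr cone_measure borel (cone_map A) = distr (distr cone_measure borel (cone_map k)) borel (cone_map R)"
      by (subst distr_distr) (auto simp: o_def cone_measure_def)
    then show ?thesis
      using rot cone_measure_reflection[OF neg] by (simp add: R_def)
  qed
qed

section \<open>The surface measure under the action on the cone\<close>

lemma space_surface_measure [simp]: "space surface_measure = sphere 0 1"
  by (simp add: surface_measure_def space_scale_measure space_restrict_space)

lemma sets_surface_measure [measurable_cong]: "sets surface_measure = sets (restrict_space borel (sphere 0 1))"
  by (simp add: surface_measure_def)

lemma borel_measurable_surface: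
  "u \<in> borel \<rightarrow>\<^sub>M N \<Longrightarrow> u \<in> surface_measure \<rightarrow>\<^sub>M N"
  by (simp add: measurable_restrict_space1 measurable_cong_sets[OF sets_surface_measure refl])

lemma nn_integral_surface:
  fixes u :: "'n::finite pt \<Rightarrow> ennreal"
  assumes u [measurable]: "u \<in> borel_measurable borel"
  shows "(\<integral>\<^sup>+x. u x \<partial>surface_measure) =
    of_nat CARD('n) * (\<integral>\<^sup>+x. u (x /\<^sub>R norm x) * indicator (cball 0 1) x \<partial>lborel)"
proof -
  let ?B = "{x :: 'n pt. 0 < norm x \<and> norm x \<le> 1}"
  have B: "?B \<in> sets borel" by measurable
  have proj: "(\<lambda>x. x /\<^sub>R norm x) \<in> restrict_space lborel ?B \<rightarrow>\<^sub>M restrict_space borel (sphere 0 1)"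
    by (intro measurable_restrict_space2 measurable_restrict_space1) (auto simp: space_restrict_space)
  have u': "u \<in> borel_measurable (restrict_space borel (sphere 0 1))"
    by (rule measurable_restrict_space1[OF u])
  have "(\<integral>\<^sup>+x. u x \<partial>surface_measure) =
     of_nat CARD('n) * (\<integral>\<^sup>+x. u (x /\<^sub>R norm x) \<partial>restrict_space lborel ?B)"
    unfolding surface_measure_def using u' proj
    by (subst nn_integral_scale_measure) (auto simp: nn_integral_distr)
  also have "(\<integral>\<^sup>+x. u (x /\<^sub>R norm x) \<partial>restrict_space lborel ?B)
     = (\<integral>\<^sup>+x. u (x /\<^sub>R norm x) * indicator ?B x \<partial>lborel)"
    using B by (subst nn_integral_restrict_space) auto
  also have "\<dots> = (\<integral>\<^sup>+x. u (x /\<^sub>R norm x) * indicator (cball 0 1) x \<partial>lborel)"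
    by (rule nn_integral_cong_AE)
       (use AE_lborel_singleton[of "0 :: 'n pt"] in \<open>eventually_elim, auto simp: indicator_def\<close>)
  finally show ?thesis .
qed

lemma finite_measure_surface_measure: "finite_measure (surface_measure :: 'n::finite pt measure)"
proof
  have "emeasure (surface_measure :: 'n pt measure) (space surface_measure) = (\<integral>\<^sup>+x. 1 \<partial>(surface_measure :: 'n pt measure))"
    by simp
  also have "\<dots> = of_nat CARD('n) * emeasure lborel (cball (0 :: 'n pt) 1)"
    by (subst nn_integral_surface) auto
  also have "\<dots> < \<infinity>"
    using emeasure_bounded_finite[of "cball (0 :: 'n pt) 1"] by (simp add: ennreal_mult_less_top of_nat_less_top)
  finally show "emeasure (surface_measure :: 'n pt measure) (space surface_measure) \<noteq> \<infinity>" by simp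
qed

lemma nn_integral_lborel_dilation:
  fixes H :: "'n::finite pt \<Rightarrow> ennreal"
  assumes t: "0 < t" and [measurable]: "H \<in> borel_measurable borel"
  shows "(\<integral>\<^sup>+x. H (t *\<^sub>R x) * ennreal (inverse (norm x ^ CARD('n))) \<partial>lborel)
       = (\<integral>\<^sup>+x. H x * ennreal (inverse (norm x ^ CARD('n))) \<partial>lborel)"
proof -
  let ?n = "CARD('n)"
  have "(\<integral>\<^sup>+x. H x * ennreal (inverse (norm x ^ ?n)) \<partial>lborel) =
    (\<integral>\<^sup>+x. H x * ennreal (inverse (norm x ^ ?n)) \<partial>density (distr lborel borel (\<lambda>x::'n pt. 0 + t *\<^sub>R x)) (\<lambda>_. \<bar>t\<bar>^DIM('n pt)))"
    using t by (subst lborel_affine[of t 0]) auto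
  also have "\<dots> = (\<integral>\<^sup>+x. ennreal (t ^ ?n) * (H (t *\<^sub>R x) * ennreal (inverse (norm (t *\<^sub>R x) ^ ?n))) \<partial>lborel)"
    using t by (subst nn_integral_density) (auto simp: nn_integral_distr ennreal_power)
  also have "\<dots> = (\<integral>\<^sup>+x. H (t *\<^sub>R x) * ennreal (inverse (norm x ^ ?n)) \<partial>lborel)"
  proof (rule nn_integral_cong)
    fix x :: "'n pt"
    have "ennreal (t ^ ?n) * ennreal (inverse (norm (t *\<^sub>R x) ^ ?n)) = ennreal (inverse (norm x ^ ?n))"
      using t by (simp add: ennreal_mult[symmetric] power_mult_distrib field_simps)
    then show "ennreal (t ^ ?n) * (H (t *\<^sub>R x) * ennreal (inverse (norm (t *\<^sub>R x) ^ ?n)))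
       = H (t *\<^sub>R x) * ennreal (inverse (norm x ^ ?n))"
      by (metis mult.left_commute)
  qed
  finally show ?thesis by simp
qed

text \<open>
  A substitute for polar coordinates.  Insert the mass of \<open>b\<close> along the ray, which is 1, interchange the
  integrals, move the dilation from \<open>b\<close> to \<open>a\<close>, and drop the mass of \<open>a\<close>.  The density \<open>|x|\<^sup>-\<^sup>n\<close> is the one
  that dilations leave invariant.
\<close>

lemma radial_average:
  fixes f a b :: "'n::finite pt \<Rightarrow> ennreal"
  assumes hom: "\<And>t x. 0 < t \<Longrightarrow> f (t *\<^sub>R x) = f x"
    and a: "\<And>x. x \<noteq> 0 \<Longrightarrow> (\<integral>\<^sup>+t. a (x /\<^sub>R t) * ennreal (inverse t) * indicator {0<..} t \<partial>lborel) = 1"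
    and b: "\<And>x. x \<noteq> 0 \<Longrightarrow> (\<integral>\<^sup>+t. b (t *\<^sub>R x) * ennreal (inverse t) * indicator {0<..} t \<partial>lborel) = 1"
    and [measurable]: "f \<in> borel_measurable borel" "a \<in> borel_measurable borel" "b \<in> borel_measurable borel"
  shows "(\<integral>\<^sup>+x. f x * a x * ennreal (inverse (norm x ^ CARD('n))) \<partial>lborel)
       = (\<integral>\<^sup>+x. f x * b x * ennreal (inverse (norm x ^ CARD('n))) \<partial>lborel)"
proof -
  define p where "p x = ennreal (inverse (norm x ^ CARD('n)))" for x :: "'n pt"
  have [measurable]: "p \<in> borel_measurable borel" unfolding p_def by measurable
  define q where "q t = ennreal (inverse t) * indicator {0<..} t" for t :: real
  have [measurable]: "q \<in> borel_measurable borel" unfolding q_def by measurable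
  have nz: "AE x in lborel. x \<noteq> (0 :: 'n pt)" by (rule AE_lborel_singleton)
  have avg: "(\<integral>\<^sup>+t. c * (g t * q t) \<partial>lborel) = c"
    if [measurable]: "g \<in> borel_measurable borel"
      and "(\<integral>\<^sup>+t. g t * ennreal (inverse t) * indicator {0<..} t \<partial>lborel) = 1" for c and g :: "real \<Rightarrow> ennreal"
  proof -
    have "(\<integral>\<^sup>+t. c * (g t * q t) \<partial>lborel) = c * (\<integral>\<^sup>+t. g t * q t \<partial>lborel)"
      by (rule nn_integral_cmult) measurable
    then show ?thesis using that(2) by (simp add: q_def mult.assoc)
  qed
  have "(\<integral>\<^sup>+x. f x * a x * p x \<partial>lborel) = (\<integral>\<^sup>+x. (\<integral>\<^sup>+t. f x * a x * p x * (b (t *\<^sub>R x) * q t) \<partial>lborel) \<partial>lborel)"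
    by (rule nn_integral_cong_AE, rule eventually_mono[OF nz], subst avg) (simp_all add: b)
  also have "\<dots> = (\<integral>\<^sup>+t. (\<integral>\<^sup>+x. f x * a x * p x * (b (t *\<^sub>R x) * q t) \<partial>lborel) \<partial>lborel)"
    by (rule lborel_pair.Fubini'[symmetric]) measurable
  also have "\<dots> = (\<integral>\<^sup>+t. (\<integral>\<^sup>+x. f x * b x * p x * (a (x /\<^sub>R t) * q t) \<partial>lborel) \<partial>lborel)"
  proof (rule nn_integral_cong)
    fix t :: real
    show "(\<integral>\<^sup>+x. f x * a x * p x * (b (t *\<^sub>R x) * q t) \<partial>lborel)
        = (\<integral>\<^sup>+x. f x * b x * p x * (a (x /\<^sub>R t) * q t) \<partial>lborel)"
    proof (cases "0 < t")
      case True
      have "(\<integral>\<^sup>+x. f x * a x * p x * (b (t *\<^sub>R x) * q t) \<partial>lborel)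
        = (\<integral>\<^sup>+x. (\<lambda>y. f y * a (y /\<^sub>R t) * b y * q t) (t *\<^sub>R x) * p x \<partial>lborel)"
        using True by (intro nn_integral_cong) (simp add: hom ac_simps)
      \<comment> \<open>Substitute t x for x; f does not change along rays.\<close>
      also have "\<dots> = (\<integral>\<^sup>+x. (f x * a (x /\<^sub>R t) * b x * q t) * p x \<partial>lborel)"
        unfolding p_def by (rule nn_integral_lborel_dilation[OF True]) measurable
      finally show ?thesis by (simp add: ac_simps)
    qed (simp add: q_def)
  qed
  also have "\<dots> = (\<integral>\<^sup>+x. (\<integral>\<^sup>+t. f x * b x * p x * (a (x /\<^sub>R t) * q t) \<partial>lborel) \<partial>lborel)"
    by (rule lborel_pair.Fubini') measurable
  also have "\<dots> = (\<integral>\<^sup>+x. f x * b x * p x \<partial>lborel)"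
    by (rule nn_integral_cong_AE, rule eventually_mono[OF nz], subst avg) (simp_all add: a)
  finally show ?thesis unfolding p_def .
qed

text \<open>
  The cone over the sphere that defines the surface measure, as a density with respect to \<open>|x|\<^sup>-\<^sup>n dx\<close>.
  The factors make its mass along each ray with respect to \<open>dt/t\<close> equal to 1.
\<close>

definition ball_weight :: "'n::finite pt \<Rightarrow> ennreal" where
  "ball_weight x = ennreal (real CARD('n) * norm x ^ CARD('n)) * indicator (cball 0 1) x"

lemma ball_weight_measurable [measurable]: "ball_weight \<in> borel_measurable borel"
proof -
  have [measurable]: "cball (0 :: 'a pt) 1 \<in> sets borel" by simp
  show "(ball_weight :: 'a pt \<Rightarrow> _) \<in> borel_measurable borel"
    unfolding ball_weight_def[abs_def] by measurable
qed

lemma ball_weight_shrink: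
  fixes x :: "'n::finite pt"
  assumes "x \<noteq> 0"
  shows "(\<integral>\<^sup>+t. ball_weight (x /\<^sub>R t) * ennreal (inverse t) * indicator {0<..} t \<partial>lborel) = 1"
proof -
  define n where "n = CARD('n)"
  have n: "0 < n" by (simp add: n_def)
  define r where "r = norm x"
  have r: "0 < r" using assms by (simp add: r_def)
  have "(\<integral>\<^sup>+t. ball_weight (x /\<^sub>R t) * ennreal (inverse t) * indicator {0<..} t \<partial>lborel)
      = (\<integral>\<^sup>+t. ennreal (if 0 < t then real n * r ^ n * inverse (t ^ Suc n) else 0) * indicator {r..} t \<partial>lborel)"
  proof (rule nn_integral_cong)
    fix t :: real
    show "ball_weight (x /\<^sub>R t) * ennreal (inverse t) * indicator {0<..} t
      = ennreal (if 0 < t then real n * r ^ n * inverse (t ^ Suc n) else 0) * indicator {r..} t"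
    proof (cases "0 < t")
      case True
      then have "ball_weight (x /\<^sub>R t) = ennreal (real n * (r / t) ^ n) * indicator {r..} t"
        by (auto simp: ball_weight_def n_def r_def indicator_def field_simps)
      moreover have "ennreal (real n * (r / t) ^ n) * ennreal (inverse t) = ennreal (real n * r ^ n * inverse (t ^ Suc n))"
        using True r by (simp add: ennreal_mult[symmetric] power_divide field_simps)
      ultimately have "ball_weight (x /\<^sub>R t) * ennreal (inverse t)
          = ennreal (real n * r ^ n * inverse (t ^ Suc n)) * indicator {r..} t"
        by (metis (no_types, lifting) mult.assoc mult.commute)
      then show ?thesis using True by simp
    qed simp
  qed
  also have "\<dots> = ennreal (0 - (- (r ^ n * inverse (r ^ n))))"
  proof (rule nn_integral_FTC_atLeast[where F = "\<lambda>t. - (r ^ n * inverse (t ^ n))"])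
    show "(\<lambda>t. if 0 < t then real n * r ^ n * inverse (t ^ Suc n) else 0) \<in> borel_measurable borel"
      by measurable
    fix t assume "r \<le> t"
    with r have t: "0 < t" by simp
    obtain m where m: "n = Suc m" using n by (cases n) auto
    have "((\<lambda>t. - (r ^ n * inverse (t ^ n))) has_real_derivative
        real n * r ^ n * inverse (t ^ Suc n)) (at t)"
    proof -
      have "((\<lambda>t. - (r ^ n * inverse (t ^ Suc m))) has_real_derivative
          - (r ^ n * - (inverse (t ^ Suc m) * (real (Suc m) * t ^ m) * inverse (t ^ Suc m)))) (at t)"
        by (rule DERIV_minus, rule DERIV_cmult, rule DERIV_inverse')
          (use t DERIV_pow[of "Suc m" t] in simp_all)
      moreover have "inverse (t ^ Suc m) * (real (Suc m) * t ^ m) * inverse (t ^ Suc m)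
          = real n * inverse (t ^ Suc n)"
        using t by (simp add: m field_simps del: of_nat_Suc)
      ultimately have "((\<lambda>t. - (r ^ n * inverse (t ^ n))) has_real_derivative
          - (r ^ n * - (real n * inverse (t ^ Suc n)))) (at t)"
        by (simp only: m)
      moreover have "- (r ^ n * - (real n * inverse (t ^ Suc n))) = real n * r ^ n * inverse (t ^ Suc n)"
        by simp
      ultimately show ?thesis by (simp only:)
    qed
    then show "((\<lambda>t. - (r ^ n * inverse (t ^ n))) has_real_derivative
        (if 0 < t then real n * r ^ n * inverse (t ^ Suc n) else 0)) (at t)" using t by simp
    show "0 \<le> (if 0 < t then real n * r ^ n * inverse (t ^ Suc n) else 0)"
      using r by simp
  next
    have "((\<lambda>t::real. inverse (t ^ n)) \<longlongrightarrow> 0) at_top"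
      using n by (intro tendsto_inverse_0_at_top filterlim_pow_at_top filterlim_ident)
    from tendsto_minus[OF tendsto_mult_right_zero[OF this, of "r ^ n"]]
    show "((\<lambda>t. - (r ^ n * inverse (t ^ n))) \<longlongrightarrow> 0) at_top" by simp
  qed
  also have "\<dots> = 1" using r by simp
  finally show ?thesis .
qed

lemma ball_weight_stretch:
  fixes x :: "'n::finite pt"
  assumes "x \<noteq> 0"
  shows "(\<integral>\<^sup>+t. ball_weight (t *\<^sub>R x) * ennreal (inverse t) * indicator {0<..} t \<partial>lborel) = 1"
proof -
  obtain m where m: "CARD('n) = Suc m" using zero_less_card_finite[where 'a='n] by (cases "CARD('n)") auto
  define r where "r = norm x"
  have r: "0 < r" using assms by (simp add: r_def)
  have "(\<integral>\<^sup>+t. ball_weight (t *\<^sub>R x) * ennreal (inverse t) * indicator {0<..} t \<partial>lborel)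
      = (\<integral>\<^sup>+t. ennreal (real (Suc m) * r ^ Suc m * t ^ m) * indicator {0..1/r} t \<partial>lborel)"
  proof (rule nn_integral_cong_AE)
    show "AE t in lborel. ball_weight (t *\<^sub>R x) * ennreal (inverse t) * indicator {0<..} t
      = ennreal (real (Suc m) * r ^ Suc m * t ^ m) * indicator {0..1/r} t"
      using AE_lborel_singleton[of "0::real"]
    proof eventually_elim
      fix t :: real assume "t \<noteq> 0"
      show "ball_weight (t *\<^sub>R x) * ennreal (inverse t) * indicator {0<..} t
        = ennreal (real (Suc m) * r ^ Suc m * t ^ m) * indicator {0..1/r} t"
      proof (cases "0 < t")
        case True
        then have "ball_weight (t *\<^sub>R x) = ennreal (real (Suc m) * (t * r) ^ Suc m) * indicator {0..1/r} t"
          using r by (auto simp: ball_weight_def m r_def[symmetric] indicator_def field_simps simp del: of_nat_Suc)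
        moreover have "ennreal (real (Suc m) * (t * r) ^ Suc m) * ennreal (inverse t) = ennreal (real (Suc m) * r ^ Suc m * t ^ m)"
          using True r by (simp add: ennreal_mult[symmetric] power_mult_distrib field_simps del: of_nat_Suc)
        ultimately have "ball_weight (t *\<^sub>R x) * ennreal (inverse t)
            = ennreal (real (Suc m) * r ^ Suc m * t ^ m) * indicator {0..1/r} t"
          by (metis (no_types, lifting) mult.assoc mult.commute)
        then show ?thesis using True by simp
      qed (use \<open>t \<noteq> 0\<close> in \<open>auto simp: indicator_def\<close>)
    qed
  qed
  also have "\<dots> = ennreal (r ^ Suc m * (1/r) ^ Suc m - r ^ Suc m * 0 ^ Suc m)"
  proof (rule nn_integral_FTC_Icc[where F = "\<lambda>t. r ^ Suc m * t ^ Suc m"])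
    fix t :: real assume "t \<in> {0..1/r}"
    then show "0 \<le> real (Suc m) * r ^ Suc m * t ^ m" using r by simp
    show "((\<lambda>t. r ^ Suc m * t ^ Suc m) has_real_derivative real (Suc m) * r ^ Suc m * t ^ m) (at t)"
      by (auto intro!: derivative_eq_intros simp del: of_nat_Suc power_Suc)
  qed (use r in auto)
  also have "\<dots> = 1" using r by (simp add: power_divide)
  finally show ?thesis .
qed

lemma nn_integral_surface_weight:
  fixes f :: "'n::finite pt \<Rightarrow> ennreal"
  assumes [measurable]: "f \<in> borel_measurable borel"
    and hom: "\<And>t x. 0 < t \<Longrightarrow> f (t *\<^sub>R x) = f x"
  shows "(\<integral>\<^sup>+x. f x \<partial>surface_measure)
    = (\<integral>\<^sup>+x. f x * ball_weight x * ennreal (inverse (norm x ^ CARD('n))) \<partial>lborel)"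
proof -
  have "(\<integral>\<^sup>+x. f x \<partial>surface_measure)
    = (\<integral>\<^sup>+x. of_nat CARD('n) * (f (x /\<^sub>R norm x) * indicator (cball 0 1) x) \<partial>lborel)"
  proof -
    have [measurable]: "cball (0 :: 'n pt) 1 \<in> sets borel" by simp
    show ?thesis
      by (subst nn_integral_surface, measurable) (rule nn_integral_cmult[symmetric], measurable)
  qed
  also have "\<dots> = (\<integral>\<^sup>+x. f x * ball_weight x * ennreal (inverse (norm x ^ CARD('n))) \<partial>lborel)"
  proof (rule nn_integral_cong_AE)
    show "AE x in lborel. of_nat CARD('n) * (f (x /\<^sub>R norm x) * indicator (cball 0 1) x)
      = f x * ball_weight x * ennreal (inverse (norm x ^ CARD('n)))"
      using AE_lborel_singleton[of "0 :: 'n pt"]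
    proof eventually_elim
      fix x :: "'n pt" assume x: "x \<noteq> 0"
      then have "f (x /\<^sub>R norm x) = f x" using hom[of "inverse (norm x)" x] by simp
      moreover have "ennreal (real CARD('n) * norm x ^ CARD('n)) * ennreal (inverse (norm x ^ CARD('n))) = of_nat CARD('n)"
        using x by (simp add: ennreal_mult[symmetric] ennreal_of_nat_eq_real_of_nat field_simps)
      ultimately show "of_nat CARD('n) * (f (x /\<^sub>R norm x) * indicator (cball 0 1) x)
         = f x * ball_weight x * ennreal (inverse (norm x ^ CARD('n)))"
        unfolding ball_weight_def by (metis (no_types, lifting) mult.assoc mult.commute)
    qed
  qed
  finally show ?thesis .
qed

lemma normalize_scale:
  fixes y :: "'a::real_normed_vector"
  assumes "0 < t"
  shows "(t *\<^sub>R y) /\<^sub>R norm (t *\<^sub>R y) = y /\<^sub>R norm y"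
  using assms by (simp add: field_simps)

text \<open>
  Apply the invariance of \<open>dx/|x|\<close> to \<open>u(y/|y|) |y|\<^bsup>-(n-1)\<^esup>\<close> times \<^const>\<open>ball_weight\<close>.  One side is the integral of
  \<open>u\<close> over the sphere.  On the other side \<open>|\<Phi>(x)|\<^bsup>-(n-1)\<^esup> / |x|\<close> is \<open>(|x| / |\<Phi>(x)|)\<^bsup>n-1\<^esup>\<close> times \<open>|x|\<^sup>-\<^sup>n\<close>, and the
  composition of \<^const>\<open>ball_weight\<close> with \<open>\<Phi>\<close> has mass 1 along rays, since \<open>\<Phi>\<close> is homogeneous, so that it
  may be replaced by \<^const>\<open>ball_weight\<close> itself.
\<close>

lemma nn_integral_surface_cone_map:
  fixes A :: "'n::{finite,linorder} lmat" and u :: "'n pt \<Rightarrow> ennreal"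
  assumes A: "A \<in> orthochronous" and [measurable]: "u \<in> borel_measurable borel"
  defines "\<Phi> \<equiv> cone_map A"
  shows "(\<integral>\<^sup>+x. u (\<Phi> x /\<^sub>R norm (\<Phi> x)) * ennreal ((norm x / norm (\<Phi> x)) ^ (CARD('n) - 1)) \<partial>surface_measure)
    = (\<integral>\<^sup>+x. u x \<partial>surface_measure)"
proof -
  define m where "m = CARD('n) - 1"
  have m: "CARD('n) = Suc m" using zero_less_card_finite[where 'a='n] by (simp add: m_def)
  have [measurable]: "\<Phi> \<in> borel_measurable borel" unfolding \<Phi>_def by measurable
  have hom: "\<Phi> (t *\<^sub>R x) = t *\<^sub>R \<Phi> x" if "0 < t" for t x
    using that by (simp add: \<Phi>_def cone_map_scale)
  have nz: "x \<noteq> 0 \<Longrightarrow> \<Phi> x \<noteq> 0" for x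
    unfolding \<Phi>_def by (rule cone_map_nonzero[OF A])
  define f where "f x = u (\<Phi> x /\<^sub>R norm (\<Phi> x)) * ennreal ((norm x / norm (\<Phi> x)) ^ m)" for x
  have [measurable]: "f \<in> borel_measurable borel" unfolding f_def by measurable
  define G where "G y = u (y /\<^sub>R norm y) * ball_weight y * ennreal (inverse (norm y ^ m))" for y
  have [measurable]: "G \<in> borel_measurable borel" unfolding G_def by measurable
  have inv: "(\<integral>\<^sup>+x. G (\<Phi> x) * ennreal (inverse (norm x)) \<partial>lborel) = (\<integral>\<^sup>+x. G x * ennreal (inverse (norm x)) \<partial>lborel)"
  proof -
    have "(\<integral>\<^sup>+x. G x \<partial>distr cone_measure borel \<Phi>) = (\<integral>\<^sup>+x. G x \<partial>cone_measure)"
      using cone_measure_invariant[OF A] by (simp add: \<Phi>_def)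
    moreover have "(\<integral>\<^sup>+x. G x \<partial>distr cone_measure borel \<Phi>) = (\<integral>\<^sup>+x. G (\<Phi> x) \<partial>cone_measure)"
      by (rule nn_integral_distr) (auto simp: cone_measure_def)
    ultimately show ?thesis
      by (simp add: cone_measure_def nn_integral_density mult.commute)
  qed
  have pw: "ennreal (inverse (norm x ^ m)) * ennreal (inverse (norm x)) = ennreal (inverse (norm x ^ CARD('n)))" for x :: "'n pt"
    by (simp add: m ennreal_mult[symmetric] mult.commute)
  have "(\<integral>\<^sup>+x. f x \<partial>surface_measure) = (\<integral>\<^sup>+x. f x * ball_weight x * ennreal (inverse (norm x ^ CARD('n))) \<partial>lborel)"
  proof (rule nn_integral_surface_weight)
    fix t :: real and x :: "'n pt" assume t: "0 < t"
    show "f (t *\<^sub>R x) = f x"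
      using t by (simp only: f_def hom[OF t] normalize_scale[OF t]) simp
  qed measurable
  also have "\<dots> = (\<integral>\<^sup>+x. f x * ball_weight (\<Phi> x) * ennreal (inverse (norm x ^ CARD('n))) \<partial>lborel)"
  proof (rule radial_average)
    fix t :: real and x :: "'n pt" assume t: "0 < t"
    show "f (t *\<^sub>R x) = f x"
      using t by (simp only: f_def hom[OF t] normalize_scale[OF t]) simp
  next
    show "(\<integral>\<^sup>+t. ball_weight (x /\<^sub>R t) * ennreal (inverse t) * indicator {0<..} t \<partial>lborel) = 1" if "x \<noteq> 0" for x :: "'n pt"
      using that by (rule ball_weight_shrink)
    show "(\<integral>\<^sup>+t. ball_weight (\<Phi> (t *\<^sub>R x)) * ennreal (inverse t) * indicator {0<..} t \<partial>lborel) = 1" if "x \<noteq> 0" for x :: "'n pt"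
    proof -
      have "(\<integral>\<^sup>+t. ball_weight (\<Phi> (t *\<^sub>R x)) * ennreal (inverse t) * indicator {0<..} t \<partial>lborel)
        = (\<integral>\<^sup>+t. ball_weight (t *\<^sub>R \<Phi> x) * ennreal (inverse t) * indicator {0<..} t \<partial>lborel)"
        by (rule nn_integral_cong) (auto simp: indicator_def hom)
      then show ?thesis using ball_weight_stretch[OF nz[OF that]] by simp
    qed
  qed measurable
  also have "\<dots> = (\<integral>\<^sup>+x. G (\<Phi> x) * ennreal (inverse (norm x)) \<partial>lborel)"
  proof (rule nn_integral_cong_AE)
    show "AE x in lborel. f x * ball_weight (\<Phi> x) * ennreal (inverse (norm x ^ CARD('n)))
       = G (\<Phi> x) * ennreal (inverse (norm x))"
      using AE_lborel_singleton[of "0 :: 'n pt"]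
    proof eventually_elim
      fix x :: "'n pt" assume x: "x \<noteq> 0"
      have "ennreal ((norm x / norm (\<Phi> x)) ^ m) * ennreal (inverse (norm x ^ CARD('n)))
         = ennreal (inverse (norm (\<Phi> x) ^ m)) * ennreal (inverse (norm x))"
        using x nz[OF x] by (simp add: m ennreal_mult[symmetric] power_divide field_simps)
      then have "\<And>v w. v * ennreal ((norm x / norm (\<Phi> x)) ^ m) * w * ennreal (inverse (norm x ^ CARD('n)))
         = v * w * ennreal (inverse (norm (\<Phi> x) ^ m)) * ennreal (inverse (norm x))"
        by (metis (no_types) mult.assoc mult.commute)
      then show "f x * ball_weight (\<Phi> x) * ennreal (inverse (norm x ^ CARD('n)))
         = G (\<Phi> x) * ennreal (inverse (norm x))"
        unfolding f_def G_def .
    qed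
  qed
  also have "\<dots> = (\<integral>\<^sup>+x. G x * ennreal (inverse (norm x)) \<partial>lborel)" by (rule inv)
  also have "\<dots> = (\<integral>\<^sup>+x. u (x /\<^sub>R norm x) * ball_weight x * ennreal (inverse (norm x ^ CARD('n))) \<partial>lborel)"
    unfolding G_def by (simp only: mult.assoc pw)
  also have "\<dots> = (\<integral>\<^sup>+x. u (x /\<^sub>R norm x) \<partial>surface_measure)"
  proof (rule nn_integral_surface_weight[symmetric])
    fix t :: real and x :: "'n pt" assume "0 < t"
    then show "u ((t *\<^sub>R x) /\<^sub>R norm (t *\<^sub>R x)) = u (x /\<^sub>R norm x)"
      by (simp only: normalize_scale)
  qed measurable
  also have "\<dots> = (\<integral>\<^sup>+x. u x \<partial>surface_measure)"
    by (rule nn_integral_cong) auto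
  finally show ?thesis unfolding f_def m_def .
qed

section \<open>The conformal action on the sphere\<close>

lemma lift_eq_null_lift: "norm x = 1 \<Longrightarrow> lift x = null_lift x"
  by (simp only: lift_def null_lift_def)

lemma space_part_lift [simp]: "space_part (lift x) = x"
  by (simp add: lift_def space_part_def vec_eq_iff)

lemma kappa_eq:
  assumes "A \<in> orthochronous" "norm x = 1"
  shows "kappa A x = inverse (norm (cone_map A x))"
  using assms by (simp add: kappa_def lift_eq_null_lift norm_cone_map)

lemma cone_map_pos:
  assumes "A \<in> orthochronous" "norm x = 1"
  shows "0 < norm (cone_map A x)"
proof -
  have "x \<noteq> 0" using assms by auto
  then show ?thesis using cone_map_nonzero[OF assms(1)] by simp
qed

lemma kappa_pos: "A \<in> orthochronous \<Longrightarrow> norm x = 1 \<Longrightarrow> 0 < kappa A x"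
  by (simp only: kappa_eq inverse_positive_iff_positive cone_map_pos)

lemma act_eq:
  assumes A: "A \<in> orthochronous" and x: "norm x = 1"
  shows "act A x = cone_map A x /\<^sub>R norm (cone_map A x)"
proof -
  let ?y = "cone_map A x /\<^sub>R norm (cone_map A x)"
  note pos = cone_map_pos[OF A x]
  have y: "norm ?y = 1" using pos by simp
  have eq: "kappa A x *\<^sub>R (A *v lift x) = lift ?y"
    using pos y unfolding lift_eq_null_lift[OF y] lift_eq_null_lift[OF x] orthochronous_null_lift[OF A] kappa_eq[OF A x]
    by (intro lvec_eqI) auto
  show ?thesis unfolding act_def
  proof (rule the_equality)
    show "?y \<in> sphere 0 1 \<and> lift ?y = kappa A x *\<^sub>R (A *v lift x)" using y eq by simp
    fix z assume "z \<in> sphere 0 1 \<and> lift z = kappa A x *\<^sub>R (A *v lift x)"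
    then have "lift z = lift ?y" using eq by simp
    then show "z = ?y" by (metis space_part_lift)
  qed
qed

lemma cone_map_act: "A \<in> orthochronous \<Longrightarrow> norm x = 1 \<Longrightarrow> cone_map A x = act A x /\<^sub>R kappa A x"
  using cone_map_pos[of A x] by (simp add: act_eq kappa_eq)

lemma norm_act: "A \<in> orthochronous \<Longrightarrow> norm x = 1 \<Longrightarrow> norm (act A x) = 1"
  using cone_map_pos[of A x] by (simp add: act_eq)

lemma orthochronous_one: "mat 1 \<in> orthochronous"
  by (simp add: orthochronous_def)

lemma cone_map_one [simp]: "cone_map (mat 1) x = x"
  by (simp add: cone_map_def)

lemma act_one: "norm x = 1 \<Longrightarrow> act (mat 1) x = x"
  and kappa_one: "norm x = 1 \<Longrightarrow> kappa (mat 1) x = 1"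
  by (simp_all add: act_eq kappa_eq orthochronous_one)

lemma
  assumes A: "A \<in> orthochronous" and B: "B \<in> orthochronous" and x: "norm x = 1"
  shows act_mult: "act (A ** B) x = act A (act B x)"
    and kappa_mult: "kappa (A ** B) x = kappa A (act B x) * kappa B x"
proof -
  note AB = orthochronous_mult[OF A B]
  note y = norm_act[OF B x]
  have pos: "0 < kappa B x" by (rule kappa_pos[OF B x])
  have c: "cone_map (A ** B) x = cone_map A (act B x) /\<^sub>R kappa B x"
    unfolding cone_map_mult[OF B] cone_map_act[OF B x]
    using pos by (simp add: cone_map_scale)
  show "act (A ** B) x = act A (act B x)"
    using pos by (simp add: act_eq[OF AB x] act_eq[OF A y] c field_simps)
  show "kappa (A ** B) x = kappa A (act B x) * kappa B x"
    using pos by (simp add: kappa_eq[OF AB x] kappa_eq[OF A y] c)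
qed

text \<open>
  The conformal law: half the squared distance of two points of the sphere is the Minkowski product of
  the null vectors above them, which is preserved.
\<close>

lemma norm_diff_act:
  assumes A: "A \<in> orthochronous" and x: "norm x = 1" and y: "norm y = 1"
  shows "(norm (act A x - act A y))\<^sup>2 = kappa A x * kappa A y * (norm (x - y))\<^sup>2"
proof -
  have *: "(norm (x - y))\<^sup>2 = 2 * mink (null_lift x) (null_lift y)" if "norm x = 1" "norm y = 1" for x y :: "'a pt"
    using that by (simp add: mink_null_lift power2_norm_eq_inner inner_diff inner_commute)
       (simp add: power2_norm_eq_inner[symmetric])
  have "mink (null_lift x) (null_lift y) = mink (A *v null_lift x) (A *v null_lift y)"
    using A by (subst mink_preserved) (auto simp: orthochronous_def)
  also have "\<dots> = mink (null_lift (act A x)) (null_lift (act A y)) / (kappa A x * kappa A y)"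
    using kappa_pos[OF A x] kappa_pos[OF A y]
    by (simp add: orthochronous_null_lift[OF A] cone_map_act[OF A x] cone_map_act[OF A y] mink_null_lift field_simps)
  finally show ?thesis
    using kappa_pos[OF A x] kappa_pos[OF A y]
    by (simp add: *[OF x y] *[OF norm_act[OF A x] norm_act[OF A y]])
qed

lemma
  assumes A: "A \<in> orthochronous"
  shows act_measurable: "act A \<in> surface_measure \<rightarrow>\<^sub>M surface_measure"
    and kappa_measurable: "kappa A \<in> borel_measurable surface_measure"
proof -
  have "(\<lambda>x. cone_map A x /\<^sub>R norm (cone_map A x)) \<in> surface_measure \<rightarrow>\<^sub>M restrict_space borel (sphere 0 1)"
  proof (intro measurable_restrict_space2 borel_measurable_surface)
    show "(\<lambda>x. cone_map A x /\<^sub>R norm (cone_map A x)) \<in> space surface_measure \<rightarrow> sphere 0 1"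
      using cone_map_pos[OF A] by auto
  qed measurable
  then show "act A \<in> surface_measure \<rightarrow>\<^sub>M surface_measure"
    unfolding measurable_cong_sets[OF refl sets_surface_measure]
    by (rule measurable_cong[THEN iffD1, rotated]) (simp add: act_eq[OF A])
  have "(\<lambda>x. inverse (norm (cone_map A x))) \<in> borel_measurable surface_measure"
    by (rule borel_measurable_surface) measurable
  then show "kappa A \<in> borel_measurable surface_measure"
    by (rule measurable_cong[THEN iffD1, rotated]) (simp add: kappa_eq[OF A])
qed

text \<open>
  The Jacobian of the action is \<open>\<kappa>\<^bsup>n-1\<^esup>\<close>.  On the sphere \<open>\<kappa> = 1 / |\<Phi>|\<close>, which is the factor that occurs in
  \<open>nn_integral_surface_cone_map\<close>.
\<close>

theorem surface_measure_quasi_invariant: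
  fixes A :: "'n::{finite,linorder} lmat"
  assumes A: "A \<in> orthochronous"
  shows "distr (density surface_measure (\<lambda>x. ennreal (kappa A x ^ (CARD('n) - 1)))) surface_measure (act A)
    = surface_measure"
proof (rule measure_eqI)
  note [measurable] = act_measurable[OF A] kappa_measurable[OF A]
  fix X assume "X \<in> sets (distr (density surface_measure (\<lambda>x. ennreal (kappa A x ^ (CARD('n) - 1)))) surface_measure (act A))"
  then have X [measurable]: "X \<in> sets surface_measure" by simp
  then obtain Y where Y: "Y \<in> sets borel" "X = sphere 0 1 \<inter> Y"
    by (auto simp: sets_surface_measure sets_restrict_space)
  have [measurable]: "Y \<in> sets borel" by (rule Y)
  have "emeasure (distr (density surface_measure (\<lambda>x. ennreal (kappa A x ^ (CARD('n) - 1)))) surface_measure (act A)) X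
    = (\<integral>\<^sup>+x. indicator X x \<partial>distr (density surface_measure (\<lambda>x. ennreal (kappa A x ^ (CARD('n) - 1)))) surface_measure (act A))"
    by simp
  also have "\<dots> = (\<integral>\<^sup>+x. ennreal (kappa A x ^ (CARD('n) - 1)) * indicator X (act A x) \<partial>surface_measure)"
    by (subst nn_integral_distr, simp, simp, subst nn_integral_density) measurable
  also have "\<dots> = (\<integral>\<^sup>+x. indicator Y (cone_map A x /\<^sub>R norm (cone_map A x)) *
      ennreal ((norm x / norm (cone_map A x)) ^ (CARD('n) - 1)) \<partial>surface_measure)"
  proof (rule nn_integral_cong)
    fix x :: "'n pt" assume "x \<in> space surface_measure"
    then have x: "norm x = 1" by simp
    have "act A x \<in> sphere 0 1" using norm_act[OF A x] by simp
    then have "(indicator X (act A x) :: ennreal) = indicator Y (act A x)" by (auto simp: Y indicator_def)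
    then show "ennreal (kappa A x ^ (CARD('n) - 1)) * indicator X (act A x)
      = indicator Y (cone_map A x /\<^sub>R norm (cone_map A x)) * ennreal ((norm x / norm (cone_map A x)) ^ (CARD('n) - 1))"
      by (simp add: act_eq[OF A x] kappa_eq[OF A x] x inverse_eq_divide mult.commute)
  qed
  also have "\<dots> = (\<integral>\<^sup>+x. indicator Y x \<partial>(surface_measure :: 'n pt measure))"
    by (rule nn_integral_surface_cone_map[OF A]) measurable
  also have "\<dots> = (\<integral>\<^sup>+x. indicator X x \<partial>surface_measure)"
    by (rule nn_integral_cong) (auto simp: Y indicator_def)
  finally show "emeasure (distr (density surface_measure (\<lambda>x. ennreal (kappa A x ^ (CARD('n) - 1)))) surface_measure (act A)) X
    = emeasure surface_measure X" by simp
qed simp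

section \<open>The identity component of the Lorentz group\<close>

lemma det_SO1: "g \<in> SO1 \<Longrightarrow> det g = 1"
  and form_SO1: "g \<in> SO1 \<Longrightarrow> lorentz_form (g *v v) = lorentz_form v"
  by (auto simp: SO1_def)

lemma matrix_inv_mult:
  fixes A :: "real^'m^'m"
  assumes "det A \<noteq> 0"
  shows "A ** matrix_inv A = mat 1" "matrix_inv A ** A = mat 1"
proof -
  have "\<exists>A'. A ** A' = mat 1 \<and> A' ** A = mat 1"
    using assms invertible_det_nz[of A] by (simp add: invertible_def)
  from someI_ex[OF this] show "A ** matrix_inv A = mat 1" "matrix_inv A ** A = mat 1"
    by (auto simp: matrix_inv_def)
qed

lemma SO1_one: "mat 1 \<in> SO1"
  by (simp add: SO1_def)

lemma SO1_mult: "g \<in> SO1 \<Longrightarrow> h \<in> SO1 \<Longrightarrow> g ** h \<in> SO1"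
  by (simp add: SO1_def det_mul matrix_vector_mul_assoc[symmetric])

lemma SO1_inv:
  assumes g: "g \<in> SO1"
  shows "matrix_inv g \<in> SO1"
proof -
  have gi: "g ** matrix_inv g = mat 1"
    using det_SO1[OF g] by (intro matrix_inv_mult) simp
  have "det g * det (matrix_inv g) = 1" by (simp add: det_mul[symmetric] gi)
  then have d: "det (matrix_inv g) = 1" by (simp add: det_SO1[OF g])
  have "lorentz_form (matrix_inv g *v v) = lorentz_form v" for v
    using form_SO1[OF g, of "matrix_inv g *v v"] by (simp add: matrix_vector_mul_assoc gi)
  with d show ?thesis by (simp add: SO1_def)
qed

lemma SO1_0_iff: "g \<in> SO1_0 \<longleftrightarrow> (\<exists>T. connected T \<and> T \<subseteq> SO1 \<and> mat 1 \<in> T \<and> g \<in> T)"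
  by (simp add: SO1_0_def connected_component_def)

lemma SO1_0_imp_SO1: "g \<in> SO1_0 \<Longrightarrow> g \<in> SO1"
  by (auto simp: SO1_0_iff)

lemma SO1_0_one: "mat 1 \<in> SO1_0"
  unfolding SO1_0_iff by (rule exI[of _ "{mat 1}"]) (simp add: SO1_one)

lemma continuous_on_matrix_mult_left:
  "continuous_on X (\<lambda>B :: real^'m^'m. A ** B)"
  unfolding matrix_matrix_mult_def by (intro continuous_intros)

lemma SO1_0_mult:
  assumes g: "g \<in> SO1_0" and h: "h \<in> SO1_0"
  shows "g ** h \<in> SO1_0"
proof -
  obtain T where T: "connected T" "T \<subseteq> SO1" "mat 1 \<in> T" "h \<in> T" using h unfolding SO1_0_iff by blast
  have "connected ((\<lambda>B. g ** B) ` T)"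
    using T(1) by (intro connected_continuous_image continuous_on_matrix_mult_left)
  moreover have "(\<lambda>B. g ** B) ` T \<subseteq> SO1" using T(2) SO1_0_imp_SO1[OF g] SO1_mult by blast
  moreover have "g \<in> (\<lambda>B. g ** B) ` T" using T(3) by (force intro: rev_image_eqI)
  moreover have "g ** h \<in> (\<lambda>B. g ** B) ` T" using T(4) by blast
  ultimately have "connected_component SO1 g (g ** h)" unfolding connected_component_def by blast
  moreover have "connected_component SO1 (mat 1) g" using g by (simp add: SO1_0_def)
  ultimately show ?thesis unfolding SO1_0_def using connected_component_trans by blast
qed

lemma SO1_0_inv:
  assumes g: "g \<in> SO1_0"
  shows "matrix_inv g \<in> SO1_0"
proof -
  obtain T where T: "connected T" "T \<subseteq> SO1" "mat 1 \<in> T" "g \<in> T" using g unfolding SO1_0_iff by blast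
  note gS = SO1_0_imp_SO1[OF g]
  have "connected ((\<lambda>B. matrix_inv g ** B) ` T)"
    using T(1) by (intro connected_continuous_image continuous_on_matrix_mult_left)
  moreover have "(\<lambda>B. matrix_inv g ** B) ` T \<subseteq> SO1" using T(2) SO1_inv[OF gS] SO1_mult by blast
  moreover have "matrix_inv g \<in> (\<lambda>B. matrix_inv g ** B) ` T" using T(3) by (force intro: rev_image_eqI)
  moreover have "mat 1 \<in> (\<lambda>B. matrix_inv g ** B) ` T"
    using T(4) matrix_inv_mult(2)[of g] det_SO1[OF gS] by (force intro: rev_image_eqI)
  ultimately show ?thesis unfolding SO1_0_iff by blast
qed

text \<open>
  The time component of the image of a null vector vanishes for no matrix preserving the form, and it is
  positive for the identity matrix, hence on the whole component.
\<close>

lemma SO1_0_orthochronous: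
  fixes g :: "'n::finite lmat"
  assumes g: "g \<in> SO1_0"
  shows "g \<in> orthochronous"
proof -
  obtain T where T: "connected T" "T \<subseteq> SO1" "mat 1 \<in> T" "g \<in> T" using g unfolding SO1_0_iff by blast
  have "0 < (g *v null_lift x) $ None" if x: "x \<noteq> 0" for x
  proof (rule ccontr)
    assume neg: "\<not> 0 < (g *v null_lift x) $ None"
    \<comment> \<open>Otherwise the time component vanishes somewhere on the connected set T.\<close>
    let ?\<phi> = "\<lambda>A :: 'n lmat. (A *v null_lift x) $ None"
    have "connected (?\<phi> ` T)"
      using T(1) by (intro connected_continuous_image)
        (auto simp: matrix_vector_mult_def intro!: continuous_intros)
    moreover have "?\<phi> g \<in> ?\<phi> ` T" "norm x \<in> ?\<phi> ` T"
      using T(3,4) by (auto intro: rev_image_eqI)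
    ultimately have "0 \<in> ?\<phi> ` T"
      using neg by (intro connectedD_interval[of "?\<phi> ` T" "?\<phi> g" "norm x" 0]) auto
    then obtain A where A: "A \<in> SO1" "(A *v null_lift x) $ None = 0" using T(2) by auto
    have pres: "mink (A *v u) (A *v v) = mink u v" for u v
      using form_SO1[OF A(1)] by (intro mink_preserved) simp
    have "space_part (A *v null_lift x) \<bullet> space_part (A *v null_lift x) = 0"
      using pres[of "null_lift x" "null_lift x"] A(2) by (simp add: mink_null_lift_self) (simp add: mink_def)
    then have "A *v null_lift x = 0" using A(2) by (intro lvec_eqI) auto
    then have "mink (null_lift x) time_axis = 0"
      using pres[of "null_lift x" time_axis] by (simp add: mink_def)
    then show False using x by (simp add: mink_def)
  qed
  then show ?thesis using SO1_0_imp_SO1[OF g] by (simp add: orthochronous_def SO1_def)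
qed

lemma continuous_on_mink [continuous_intros]:
  assumes "continuous_on X f" "continuous_on X g"
  shows "continuous_on X (\<lambda>x. mink (f x) (g x))"
  unfolding mink_def
  by (intro continuous_intros assms bounded_linear.continuous_on[OF space_part_linear])

lemma continuous_on_reflection:
  assumes "\<And>a. a \<in> X \<Longrightarrow> mink a a \<noteq> 0"
  shows "continuous_on X (reflection :: 'n::finite lvec \<Rightarrow> _)"
proof -
  have eq: "reflection = (\<lambda>a :: 'n lvec. \<chi> i j. axis j 1 $ i - (2 * mink (axis j 1) a / mink a a) * a $ i)"
    by (simp add: fun_eq_iff reflection_def matrix_def vec_eq_iff)
  show ?thesis
    unfolding eq using assms by (intro continuous_intros) simp_all
qed

text \<open>
  Every spacelike vector can be pushed vertically to the hyperplane \<open>x\<^sub>0 = 0\<close> without leaving the spacelike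
  region, and the hyperplane without the origin is connected.
\<close>

lemma connected_spacelike:
  assumes "2 \<le> CARD('n::finite)"
  shows "connected {a :: 'n lvec. mink a a < 0}"
  unfolding connected_iff_connected_component
proof (intro ballI)
  let ?X = "{a :: 'n lvec. mink a a < 0}"
  have sp: "space_part a \<noteq> 0" if "mink a a < 0" for a :: "'n lvec"
    using that by (auto simp: mink_def)
  have "continuous_on UNIV (space_embed :: 'n pt \<Rightarrow> _)"
    by (intro linear_continuous_on linear_conv_bounded_linear[THEN iffD1] linear_space_embed)
  then have "connected (space_embed ` (- {0 :: 'n pt}))"
    using assms by (intro connected_continuous_image connected_punctured_universe)
      (auto intro: continuous_on_subset)
  moreover have "space_embed ` (- {0 :: 'n pt}) \<subseteq> ?X" by (auto simp: mink_def)
  ultimately have hor: "connected_component ?X (space_embed x) (space_embed y)" if "x \<noteq> 0" "y \<noteq> 0" for x y :: "'n pt"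
    unfolding connected_component_def using that by (intro exI[of _ "space_embed ` (- {0})"]) auto
  have vert: "connected_component ?X a (space_embed (space_part a))" if a: "a \<in> ?X" for a
    unfolding connected_component_def
  proof (intro exI conjI)
    show "closed_segment a (space_embed (space_part a)) \<subseteq> ?X"
    proof
      fix v assume "v \<in> closed_segment a (space_embed (space_part a))"
      then obtain u where u: "0 \<le> u" "u \<le> 1" "v = (1 - u) *\<^sub>R a + u *\<^sub>R space_embed (space_part a)"
        unfolding closed_segment_def by blast
      have s: "space_part v = space_part a" "v $ None = (1 - u) * a $ None"
        unfolding u(3) by (simp_all add: scaleR_left_distrib[symmetric])
      have "(1 - u)\<^sup>2 * (a $ None)\<^sup>2 \<le> 1 * (a $ None)\<^sup>2"
        using u by (intro mult_right_mono) (auto simp: power_le_one)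
      then show "v \<in> ?X" using a by (simp add: mink_def s power2_eq_square algebra_simps)
    qed
  qed auto
  fix a b assume ab: "a \<in> ?X" "b \<in> ?X"
  have "connected_component ?X (space_embed (space_part a)) (space_embed (space_part b))"
    using ab sp by (intro hor) auto
  then show "connected_component ?X a b"
    using vert[OF ab(1)] vert[OF ab(2)] connected_component_sym connected_component_trans by blast
qed

text \<open>
  Move \<open>a\<close> to \<open>b\<close> through spacelike vectors: the product then runs to the identity.  The determinant of a
  reflection is constant along the way, since it is 1 or -1 and depends continuously on the vector.
\<close>

lemma reflection_mult_SO1_0:
  fixes a b :: "'n::finite lvec"
  assumes "2 \<le> CARD('n)" "mink a a < 0" "mink b b < 0"
  shows "reflection a ** reflection b \<in> SO1_0"
proof -
  let ?X = "{a :: 'n lvec. mink a a < 0}"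
  have X: "connected ?X" by (rule connected_spacelike[OF assms(1)])
  have contR: "continuous_on ?X (reflection :: 'n lvec \<Rightarrow> _)" by (rule continuous_on_reflection) auto
  have det2: "det (reflection c) = 1 \<or> det (reflection c) = -1" if "mink c c < 0" for c :: "'n lvec"
  proof -
    have "det (reflection c) * det (reflection c) = 1"
      using reflection_involution[of c] that by (simp add: det_mul[symmetric])
    then show ?thesis by (simp add: square_eq_1_iff)
  qed
  have "continuous_on ?X (\<lambda>c. det (reflection c))"
    unfolding det_def using contR
    by (intro continuous_intros continuous_on_component) auto
  then have C: "connected ((\<lambda>c. det (reflection c)) ` ?X)" by (intro connected_continuous_image X)
  have det_eq: "det (reflection c) = det (reflection d)" if cd: "mink c c < 0" "mink d d < 0" for c d :: "'n lvec"
  proof (rule ccontr)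
    assume ne: "det (reflection c) \<noteq> det (reflection d)"
    let ?D = "(\<lambda>c. det (reflection c)) ` ?X"
    have "1 \<in> ?D" "-1 \<in> ?D" using ne cd det2[OF cd(1)] det2[OF cd(2)]
      by (metis (no_types, lifting) image_eqI mem_Collect_eq)+
    then have "0 \<in> ?D" using connectedD_interval[OF C, of "-1" 1 0] by simp
    then show False using det2 by force
  qed
  have SO: "reflection c ** reflection b \<in> SO1" if "mink c c < 0" for c :: "'n lvec"
  proof -
    have "det (reflection c ** reflection b) = det (reflection b ** reflection b)"
      using det_eq[OF that assms(3)] by (simp add: det_mul)
    then have "det (reflection c ** reflection b) = 1" using assms(3) by (simp add: reflection_involution)
    then show ?thesis
      using that assms(3) by (simp add: SO1_def matrix_vector_mul_assoc[symmetric] lorentz_form_reflection)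
  qed
  have "continuous_on ?X (\<lambda>c. reflection c ** reflection b)"
    unfolding matrix_matrix_mult_def using contR
    by (intro continuous_intros continuous_on_component) auto
  then have "connected ((\<lambda>c. reflection c ** reflection b) ` ?X)" by (intro connected_continuous_image X)
  moreover have "(\<lambda>c. reflection c ** reflection b) ` ?X \<subseteq> SO1" using SO by auto
  moreover have "mat 1 \<in> (\<lambda>c. reflection c ** reflection b) ` ?X"
    using assms(3) by (intro image_eqI[of _ _ b]) (auto simp: reflection_involution)
  moreover have "reflection a ** reflection b \<in> (\<lambda>c. reflection c ** reflection b) ` ?X"
    using assms(2) by auto
  ultimately show ?thesis unfolding SO1_0_iff by blast
qed

section \<open>Transitivity on pairs of distinct points\<close>

text \<open>
  As \<open>u\<close> and \<open>v\<close> are null, the square of \<open>u - v\<close> is -2 times their product, so that \<open>u - v\<close> is spacelike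
  and the coefficient in its reflection is 1 up to sign.
\<close>

lemma reflection_swap:
  assumes "mink u u = 0" "mink v v = 0" "0 < mink u v"
  shows "mink (u - v) (u - v) < 0" "reflection (u - v) *v u = v"
proof -
  have 1: "mink (u - v) (u - v) = - (2 * mink u v)" "mink u (u - v) = - mink u v"
    using assms by (simp_all add: mink_simps mink_commute[of v u])
  show "mink (u - v) (u - v) < 0" using 1 assms(3) by simp
  show "reflection (u - v) *v u = v" unfolding reflection_apply 1 using assms(3) by simp
qed

lemma reflection_fix: "mink v a = 0 \<Longrightarrow> reflection a *v v = v"
  by (simp add: reflection_apply)

lemma mink_null_lift_pos:
  assumes "norm x = 1" "norm y = 1" "x \<noteq> y"
  shows "0 < mink (null_lift x) (null_lift y)"
proof -
  have "x \<bullet> y \<noteq> norm x * norm y" unfolding norm_cauchy_schwarz_eq using assms by simp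
  moreover have "x \<bullet> y \<le> norm x * norm y" by (rule norm_cauchy_schwarz)
  ultimately show ?thesis by (simp add: mink_null_lift)
qed

lemma one_minus_eq: "one_minus = - one_plus"
  by (simp add: one_plus_def one_minus_def vec_eq_iff axis_def)

lemma norm_one_pm [simp]: "norm (one_plus :: 'n::{finite,linorder} pt) = 1" "norm (one_minus :: 'n pt) = 1"
  unfolding one_minus_eq norm_minus_cancel by (simp_all add: one_plus_def)

text \<open>
  A first reflection takes \<open>1\<^sup>+\<close> to \<open>s\<close> and \<open>1\<^sup>-\<close> to the direction of some \<open>w\<close>; a second one fixes the null
  vector over \<open>s\<close> and takes \<open>w\<close> to the direction of \<open>t\<close>.  If there is nothing to move, a reflection that
  fixes the vectors concerned is used, so that the number of reflections remains even.
\<close>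

lemma transitive_on_pairs:
  fixes s t :: "'n::{finite,linorder} pt"
  assumes n: "2 \<le> CARD('n)" and s: "norm s = 1" and t: "norm t = 1" and st: "s \<noteq> t"
  obtains g where "g \<in> SO1_0" "act g one_plus = s" "act g one_minus = t"
proof -
  let ?p = "null_lift (one_plus :: 'n pt)" and ?m = "null_lift (one_minus :: 'n pt)"
  let ?s = "null_lift s" and ?t = "null_lift t"
  obtain j :: 'n where j: "j \<noteq> Min UNIV"
  proof -
    have "\<exists>j. j \<noteq> Min (UNIV :: 'n set)"
    proof (rule ccontr)
      assume "\<nexists>j. j \<noteq> Min (UNIV :: 'n set)"
      then have "UNIV = {Min (UNIV :: 'n set)}" by auto
      then have "CARD('n) = 1" by (metis card_1_singleton_iff One_nat_def)
      then show False using n by simp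
    qed
    then show ?thesis using that by blast
  qed
  define e :: "'n lvec" where "e = space_embed (axis j 1)"
  have e0: "e $ None = 0" "space_part e = axis j 1" by (simp_all add: e_def)
  have ee: "mink e e < 0" by (simp add: mink_def e0 inner_axis)
  have ep: "mink ?p e = 0" "mink ?m e = 0"
    using j by (auto simp: mink_def e0 inner_axis one_plus_def one_minus_def) (auto simp: axis_def)
  have "\<exists>a. mink a a < 0 \<and> reflection a *v ?p = ?s"
  proof (cases "s = one_plus")
    case True
    then show ?thesis using ee ep reflection_fix by blast
  next
    case False
    then have "0 < mink ?p ?s" using s by (intro mink_null_lift_pos) auto
    from reflection_swap[OF mink_null_lift_self mink_null_lift_self this] show ?thesis by blast
  qed
  then obtain a where a: "mink a a < 0" and as: "reflection a *v ?p = ?s" by blast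
  define R where "R = reflection a"
  have R: "R \<in> orthochronous" unfolding R_def by (rule reflection_orthochronous[OF a])
  have pres: "mink (R *v u) (R *v v) = mink u v" for u v
    using R by (intro mink_preserved) (simp add: orthochronous_def)
  define w where "w = cone_map R one_minus"
  have Rm: "R *v ?m = null_lift w" unfolding w_def by (rule orthochronous_null_lift[OF R])
  have Rp: "R *v ?p = ?s" using as by (simp add: R_def)
  have w0: "w \<noteq> 0" unfolding w_def by (rule cone_map_nonzero[OF R]) (metis norm_one_pm(2) norm_zero zero_neq_one)
  have ws: "mink (null_lift w) ?s = 2"
  proof -
    have "mink (null_lift w) ?s = mink ?m ?p" unfolding Rm[symmetric] Rp[symmetric] by (rule pres)
    also have "\<dots> = 2"
      by (simp add: mink_null_lift one_minus_eq) (simp add: power2_norm_eq_inner[symmetric] dot_square_norm)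
    finally show ?thesis .
  qed
  have ts: "0 < mink ?t ?s" using s t st by (intro mink_null_lift_pos) auto
  have "\<exists>b d. mink b b < 0 \<and> 0 < d \<and> reflection b *v ?s = ?s \<and> reflection b *v null_lift w = d *\<^sub>R ?t"
  proof (cases "mink (null_lift w) ?t = 0")
    case True
    then have "w \<bullet> t = norm w * norm t" by (simp add: mink_null_lift)
    then have "w = norm w *\<^sub>R t" unfolding norm_cauchy_schwarz_eq using t by simp
    then have wt: "null_lift w = norm w *\<^sub>R ?t"
      using t by (intro lvec_eqI) auto
    have "mink ?s (R *v e) = 0" "mink (null_lift w) (R *v e) = 0"
      unfolding Rm[symmetric] Rp[symmetric] pres by (rule ep)+
    moreover have "mink (R *v e) (R *v e) < 0" unfolding pres by (rule ee)
    ultimately show ?thesis using w0 wt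
      by (intro exI[of _ "R *v e"] exI[of _ "norm w"]) (auto simp: reflection_fix)
  next
    case False
    moreover have "0 \<le> mink (null_lift w) ?t"
      using norm_cauchy_schwarz[of w t] by (simp add: mink_null_lift)
    ultimately have wt: "0 < mink (null_lift w) ?t" by simp
    \<comment> \<open>This scaling makes the vector of the reflection orthogonal to the null vector over s.\<close>
    define c where "c = mink ?t ?s / 2"
    have c: "0 < c" using ts by (simp add: c_def)
    let ?u = "c *\<^sub>R null_lift w"
    have uu: "mink ?u ?u = 0" "0 < mink ?u ?t"
      using wt c by (simp_all add: mink_simps mink_null_lift_self)
    note sw = reflection_swap[OF uu(1) mink_null_lift_self[of t] uu(2)]
    have "mink ?s (?u - ?t) = 0"
      using ws by (simp add: mink_simps mink_commute[of ?s] c_def)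
    then have "reflection (?u - ?t) *v ?s = ?s" by (rule reflection_fix)
    moreover have "c *\<^sub>R (reflection (?u - ?t) *v null_lift w) = ?t"
      using sw(2) by (simp add: matrix_vector_mult_scaleR)
    then have "reflection (?u - ?t) *v null_lift w = inverse c *\<^sub>R ?t"
      using c by (metis divideR_right less_irrefl scaleR_scaleR left_inverse scaleR_one)
    ultimately show ?thesis using sw(1) c by (intro exI[of _ "?u - ?t"] exI[of _ "inverse c"]) auto
  qed
  then obtain b d where b: "mink b b < 0" "0 < d" "reflection b *v ?s = ?s" "reflection b *v null_lift w = d *\<^sub>R ?t"
    by blast
  define g where "g = reflection b ** R"
  have g: "g \<in> SO1_0" unfolding g_def R_def by (rule reflection_mult_SO1_0[OF n b(1) a])
  note go = SO1_0_orthochronous[OF g]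
  have gp: "cone_map g one_plus = s" and gm: "cone_map g one_minus = d *\<^sub>R t"
    by (simp_all add: cone_map_def g_def matrix_vector_mul_assoc[symmetric] Rp Rm b)
  show thesis
  proof (rule that[OF g])
    show "act g one_plus = s" unfolding act_eq[OF go norm_one_pm(1)] gp by (simp add: s)
    show "act g one_minus = t" unfolding act_eq[OF go norm_one_pm(2)] gm using b(2) by (simp add: t)
  qed
qed

text \<open>
  The coset determines its pair because the elements of the stabiliser fix both base points.
\<close>

lemma
  assumes "C \<in> G_mod_H"
  shows coset_rep_in: "coset_rep C \<in> SO1_0"
    and coset_pair_eq: "g \<in> SO1_0 \<Longrightarrow> C = (\<lambda>h. g ** h) ` H_stab \<Longrightarrow> coset_pair C = (act g one_plus, act g one_minus)"
proof -
  have rep: "\<exists>h\<in>H_stab. coset_rep C = g ** h" if "C = (\<lambda>h. g ** h) ` H_stab" for g :: "'a lmat"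
  proof -
    have "mat 1 \<in> (H_stab :: 'a lmat set)" by (simp add: H_stab_def SO1_0_one act_one)
    then have "\<exists>x. x \<in> C" using that by blast
    then have "coset_rep C \<in> C" unfolding coset_rep_def by (rule someI_ex)
    then show ?thesis using that by blast
  qed
  from assms obtain g0 where "g0 \<in> SO1_0" "C = (\<lambda>h. g0 ** h) ` H_stab" unfolding G_mod_H_def by blast
  with rep[of g0] show "coset_rep C \<in> SO1_0" by (auto simp: H_stab_def intro: SO1_0_mult)
  assume g: "g \<in> SO1_0" "C = (\<lambda>h. g ** h) ` H_stab"
  then obtain h where h: "h \<in> H_stab" "coset_rep C = g ** h" using rep by blast
  then show "coset_pair C = (act g one_plus, act g one_minus)"
    using g(1) by (auto simp: coset_pair_def H_stab_def act_mult SO1_0_orthochronous)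
qed

lemma coset_pair_surj:
  fixes s t :: "'n::{finite,linorder} pt"
  assumes "2 \<le> CARD('n)" "norm s = 1" "norm t = 1" "s \<noteq> t"
  shows "(s, t) \<in> coset_pair ` G_mod_H"
proof -
  obtain g where g: "g \<in> SO1_0" "act g one_plus = s" "act g one_minus = t"
    using transitive_on_pairs[OF assms] by blast
  have G: "(\<lambda>h. g ** h) ` H_stab \<in> G_mod_H" using g(1) unfolding G_mod_H_def by blast
  show ?thesis
    by (rule image_eqI[OF _ G]) (simp add: coset_pair_eq[OF G g(1) refl] g)
qed

section \<open>Invariant measures on pairs and triples of points\<close>

lemma sigma_finite_surface: "sigma_finite_measure (surface_measure :: 'n::finite pt measure)"
  using finite_measure_surface_measure by (rule finite_measure.axioms(1))

lemma ident_surface [measurable]: "(\<lambda>x. x) \<in> borel_measurable surface_measure"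
  by (rule borel_measurable_surface) simp

definition offdiag_weight :: "'n::finite pt \<times> 'n pt \<Rightarrow> ennreal" where
  "offdiag_weight = (\<lambda>(s, t). ennreal (norm (s - t) powr (- 2 * (real CARD('n) - 1))))"

abbreviation sphere_pairs :: "('n::finite pt \<times> 'n pt) measure" where
  "sphere_pairs \<equiv> surface_measure \<Otimes>\<^sub>M surface_measure"

lemma fst_pairs [measurable]: "fst \<in> borel_measurable (sphere_pairs :: ('n::finite pt \<times> 'n pt) measure)"
  and snd_pairs [measurable]: "snd \<in> borel_measurable (sphere_pairs :: ('n::finite pt \<times> 'n pt) measure)"
  using measurable_compose[OF measurable_fst ident_surface] measurable_compose[OF measurable_snd ident_surface]
  by simp_all

lemma offdiag_weight_measurable [measurable]:
  "offdiag_weight \<in> borel_measurable (sphere_pairs :: ('n::finite pt \<times> 'n pt) measure)"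
  unfolding offdiag_weight_def split_beta' by measurable

lemma offdiag_measurable:
  "{(s, t). s \<noteq> t} \<inter> space sphere_pairs \<in> sets (sphere_pairs :: ('n::finite pt \<times> 'n pt) measure)"
proof -
  have "{p \<in> space (sphere_pairs :: ('n pt \<times> 'n pt) measure). norm (fst p - snd p) \<noteq> 0} \<in> sets sphere_pairs"
    by measurable
  moreover have "{p \<in> space (sphere_pairs :: ('n pt \<times> 'n pt) measure). norm (fst p - snd p) \<noteq> 0}
      = {(s, t). s \<noteq> t} \<inter> space sphere_pairs"
    by auto
  ultimately show ?thesis by simp
qed

lemma offdiag_measure_eq:
  "offdiag_measure = density (restrict_space sphere_pairs {(s, t). s \<noteq> t}) offdiag_weight"
  by (simp add: offdiag_measure_def offdiag_weight_def)

lemma space_offdiag: "space (offdiag_measure :: ('n::finite pt \<times> 'n pt) measure)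
    = {(s, t). norm s = 1 \<and> norm t = 1 \<and> s \<noteq> t}"
  by (auto simp: offdiag_measure_eq space_restrict_space space_pair_measure)

lemma sets_offdiag:
  "X \<in> sets offdiag_measure \<longleftrightarrow> X \<in> sets sphere_pairs \<and> X \<subseteq> {(s, t). s \<noteq> t}"
  unfolding offdiag_measure_eq sets_density
  by (subst sets_restrict_space_iff[OF offdiag_measurable]) auto

lemma emeasure_offdiag:
  assumes X: "X \<in> sets offdiag_measure"
  shows "emeasure offdiag_measure X = (\<integral>\<^sup>+p. offdiag_weight p * indicator X p \<partial>sphere_pairs)"
proof -
  have "emeasure offdiag_measure X =
      (\<integral>\<^sup>+p. offdiag_weight p * indicator X p \<partial>restrict_space sphere_pairs {(s, t). s \<noteq> t})"
    using X unfolding offdiag_measure_eq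
    by (subst emeasure_density) (auto intro: measurable_restrict_space1)
  also have "\<dots> = (\<integral>\<^sup>+p. offdiag_weight p * indicator X p * indicator {(s, t). s \<noteq> t} p \<partial>sphere_pairs)"
    by (rule nn_integral_restrict_space) (rule offdiag_measurable)
  also have "\<dots> = (\<integral>\<^sup>+p. offdiag_weight p * indicator X p \<partial>sphere_pairs)"
    using X by (intro nn_integral_cong) (auto simp: sets_offdiag indicator_def)
  finally show ?thesis .
qed

lemma sigma_finite_offdiag: "sigma_finite_measure (offdiag_measure :: ('n::finite pt \<times> 'n pt) measure)"
proof -
  have "finite_measure (sphere_pairs :: ('n pt \<times> 'n pt) measure)"
    by (rule finite_measure_pair_measure) (rule finite_measure_surface_measure)+
  then interpret P: finite_measure "sphere_pairs :: ('n pt \<times> 'n pt) measure" .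
  have "finite_measure (restrict_space (sphere_pairs :: ('n pt \<times> 'n pt) measure) {(s, t). s \<noteq> t})"
  proof
    show "emeasure (restrict_space sphere_pairs {(s, t). s \<noteq> t})
        (space (restrict_space (sphere_pairs :: ('n pt \<times> 'n pt) measure) {(s, t). s \<noteq> t})) \<noteq> \<infinity>"
      unfolding space_restrict_space
      by (subst emeasure_restrict_space[OF offdiag_measurable]) auto
  qed
  then interpret R: finite_measure "restrict_space (sphere_pairs :: ('n pt \<times> 'n pt) measure) {(s, t). s \<noteq> t}" .
  show ?thesis unfolding offdiag_measure_eq
    by (subst R.sigma_finite_iff_density_finite)
      (auto intro: measurable_restrict_space1 simp: offdiag_weight_def)
qed

lemma sphere_pairs_quasi_invariant:
  fixes A :: "'n::{finite,linorder} lmat"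
  assumes A: "A \<in> orthochronous"
  shows "distr (density sphere_pairs (\<lambda>(x, y). ennreal (kappa A x ^ (CARD('n) - 1)) * ennreal (kappa A y ^ (CARD('n) - 1))))
      sphere_pairs (\<lambda>(x, y). (act A x, act A y)) = sphere_pairs"
proof -
  note [measurable] = act_measurable[OF A] kappa_measurable[OF A]
  let ?k = "\<lambda>x. ennreal (kappa A x ^ (CARD('n) - 1))"
  let ?d = "density surface_measure ?k"
  have q: "distr ?d surface_measure (act A) = surface_measure"
    by (rule surface_measure_quasi_invariant[OF A])
  have sf: "sigma_finite_measure ?d"
  proof (rule sigma_finite_measure_distr)
    show "sigma_finite_measure (distr ?d surface_measure (act A))"
      unfolding q by (rule sigma_finite_surface)
  qed measurable
  have "sphere_pairs = distr ?d surface_measure (act A) \<Otimes>\<^sub>M distr ?d surface_measure (act A)"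
    by (simp only: q)
  also have "\<dots> = distr (?d \<Otimes>\<^sub>M ?d) sphere_pairs (\<lambda>(x, y). (act A x, act A y))"
    by (rule pair_measure_distr) (measurable, unfold q, rule sigma_finite_surface)
  also have "?d \<Otimes>\<^sub>M ?d = density sphere_pairs (\<lambda>(x, y). ?k x * ?k y)"
    by (rule pair_measure_density) (measurable, rule sigma_finite_surface, rule sf)
  finally show ?thesis ..
qed

text \<open>
  By the conformal law the weight \<open>|x - y|\<^bsup>-2(n-1)\<^esup>\<close> absorbs the Jacobians at both points.  On the diagonal both
  sides are 0, because \<open>0 powr r = 0\<close>.
\<close>

lemma offdiag_weight_act:
  fixes A :: "'n::finite lmat"
  assumes A: "A \<in> orthochronous" and x: "norm x = 1" and y: "norm y = 1"
  shows "ennreal (kappa A x ^ (CARD('n) - 1)) * ennreal (kappa A y ^ (CARD('n) - 1)) * offdiag_weight (act A x, act A y)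
    = offdiag_weight (x, y)"
proof -
  define m where "m = CARD('n) - 1"
  have m: "real CARD('n) - 1 = real m" by (simp add: m_def of_nat_diff)
  define c where "c = kappa A x * kappa A y"
  have c: "0 < c" using kappa_pos[OF A x] kappa_pos[OF A y] by (simp add: c_def)
  have p: "u powr (- 2 * real m) = inverse ((u\<^sup>2) ^ m)" if "0 \<le> u" "u \<noteq> 0" for u :: real
    using that by (simp add: powr_minus powr_realpow power_mult[symmetric] flip: of_nat_mult)
       (metis of_nat_mult of_nat_numeral powr_realpow order_le_less)
  show ?thesis
  proof (cases "x = y")
    case False
    have n2: "(norm (act A x - act A y))\<^sup>2 = c * (norm (x - y))\<^sup>2"
      unfolding c_def by (rule norm_diff_act[OF A x y])
    then have ne: "norm (act A x - act A y) \<noteq> 0" "norm (x - y) \<noteq> 0" using c False by auto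
    have "c ^ m * (norm (act A x - act A y) powr (- 2 * real m)) = norm (x - y) powr (- 2 * real m)"
      using ne c by (simp only: p[OF norm_ge_zero ne(1)] p[OF norm_ge_zero ne(2)] n2)
         (simp add: power_mult_distrib field_simps)
    then show ?thesis
      using kappa_pos[OF A x] kappa_pos[OF A y]
      by (simp add: offdiag_weight_def m m_def[symmetric] c_def power_mult_distrib ennreal_mult[symmetric] del: One_nat_def)
  qed (simp add: offdiag_weight_def)
qed

theorem offdiag_measure_invariant:
  fixes A :: "'n::{finite,linorder} lmat"
  assumes A: "A \<in> orthochronous"
  shows "(\<lambda>(x, y). (act A x, act A y)) \<in> offdiag_measure \<rightarrow>\<^sub>M offdiag_measure" (is "?H \<in> _")
    and "distr offdiag_measure offdiag_measure (\<lambda>(x, y). (act A x, act A y)) = offdiag_measure"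
proof -
  note [measurable] = act_measurable[OF A] kappa_measurable[OF A]
  let ?k = "\<lambda>x. ennreal (kappa A x ^ (CARD('n) - 1))"
  have HP [measurable]: "?H \<in> sphere_pairs \<rightarrow>\<^sub>M sphere_pairs" by measurable
  have ne: "act A x \<noteq> act A y" if "norm x = 1" "norm y = 1" "x \<noteq> y" for x y
    using norm_diff_act[OF A that(1,2)] kappa_pos[OF A that(1)] kappa_pos[OF A that(2)] that(3) by auto
  have sp: "?H p \<in> space offdiag_measure" if "p \<in> space offdiag_measure" for p
    using that ne by (auto simp: space_offdiag norm_act[OF A])
  have pre: "?H -` X \<inter> space offdiag_measure = (?H -` X \<inter> space sphere_pairs) \<inter> ({(s, t). s \<noteq> t} \<inter> space sphere_pairs)" for X
    by (auto simp: space_offdiag space_pair_measure)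
  have meas: "?H -` X \<inter> space offdiag_measure \<in> sets offdiag_measure" if "X \<in> sets offdiag_measure" for X
  proof -
    have "X \<in> sets sphere_pairs" using that by (simp add: sets_offdiag)
    then have "?H -` X \<inter> space offdiag_measure \<in> sets sphere_pairs"
      unfolding pre by (intro sets.Int measurable_sets[OF HP] offdiag_measurable)
    then show ?thesis by (auto simp: sets_offdiag space_offdiag)
  qed
  show H: "?H \<in> offdiag_measure \<rightarrow>\<^sub>M offdiag_measure"
    by (rule measurableI; (rule sp meas)?; assumption)
  show "distr offdiag_measure offdiag_measure ?H = offdiag_measure"
  proof (rule measure_eqI)
    fix X assume "X \<in> sets (distr offdiag_measure offdiag_measure ?H)"
    then have X: "X \<in> sets offdiag_measure" by simp
    then have [measurable]: "X \<in> sets sphere_pairs" and Xd: "X \<subseteq> {(s, t). s \<noteq> t}" by (auto simp: sets_offdiag)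
    have "emeasure offdiag_measure X = (\<integral>\<^sup>+p. offdiag_weight p * indicator X p \<partial>sphere_pairs)"
      by (rule emeasure_offdiag[OF X])
    also have "\<dots> = (\<integral>\<^sup>+p. offdiag_weight p * indicator X p
        \<partial>distr (density sphere_pairs (\<lambda>(x, y). ?k x * ?k y)) sphere_pairs ?H)"
      by (simp only: sphere_pairs_quasi_invariant[OF A])
    also have "\<dots> = (\<integral>\<^sup>+p. offdiag_weight (?H p) * indicator X (?H p) \<partial>density sphere_pairs (\<lambda>(x, y). ?k x * ?k y))"
      by (rule nn_integral_distr) measurable
    also have "\<dots> = (\<integral>\<^sup>+p. (case p of (x, y) \<Rightarrow> ?k x * ?k y) * (offdiag_weight (?H p) * indicator X (?H p)) \<partial>sphere_pairs)"
      by (rule nn_integral_density) measurable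
    also have "\<dots> = (\<integral>\<^sup>+p. offdiag_weight p * indicator (?H -` X \<inter> space offdiag_measure) p \<partial>sphere_pairs)"
    proof (rule nn_integral_cong)
      fix p :: "'n pt \<times> 'n pt" assume "p \<in> space sphere_pairs"
      then obtain x y where p: "p = (x, y)" "norm x = 1" "norm y = 1" by (auto simp: space_pair_measure)
      have "(indicator X (?H p) :: ennreal) = indicator (?H -` X \<inter> space offdiag_measure) p"
        using Xd p by (auto simp: indicator_def space_offdiag)
      moreover have "?k x * ?k y * offdiag_weight (act A x, act A y) = offdiag_weight (x, y)"
        by (rule offdiag_weight_act[OF A p(2,3)])
      ultimately show "(case p of (x, y) \<Rightarrow> ?k x * ?k y) * (offdiag_weight (?H p) * indicator X (?H p))
        = offdiag_weight p * indicator (?H -` X \<inter> space offdiag_measure) p"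
        by (simp add: p(1) mult.assoc[symmetric])
    qed
    also have "\<dots> = emeasure offdiag_measure (?H -` X \<inter> space offdiag_measure)"
      by (rule emeasure_offdiag[OF meas[OF X], symmetric])
    also have "\<dots> = emeasure (distr offdiag_measure offdiag_measure ?H) X"
      by (rule emeasure_distr[OF H X, symmetric])
    finally show "emeasure (distr offdiag_measure offdiag_measure ?H) X = emeasure offdiag_measure X" ..
  qed simp
qed

abbreviation triples :: "(('n::finite pt \<times> 'n pt) \<times> 'n pt) measure" where
  "triples \<equiv> offdiag_measure \<Otimes>\<^sub>M surface_measure"

definition act_triple :: "'n::finite lmat \<Rightarrow> ('n pt \<times> 'n pt) \<times> 'n pt \<Rightarrow> ('n pt \<times> 'n pt) \<times> 'n pt" where
  "act_triple A = (\<lambda>(p, s). ((\<lambda>(x, y). (act A x, act A y)) p, act A s))"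

lemma triples_quasi_invariant:
  fixes A :: "'n::{finite,linorder} lmat"
  assumes A: "A \<in> orthochronous"
  shows "act_triple A \<in> triples \<rightarrow>\<^sub>M triples"
    and "distr (density triples (\<lambda>(p, s). ennreal (kappa A s ^ (CARD('n) - 1)))) triples (act_triple A) = triples"
proof -
  note [measurable] = act_measurable[OF A] kappa_measurable[OF A] offdiag_measure_invariant(1)[OF A]
  let ?k = "\<lambda>x. ennreal (kappa A x ^ (CARD('n) - 1))"
  let ?d = "density surface_measure ?k" and ?M = "offdiag_measure :: ('n pt \<times> 'n pt) measure"
  let ?H = "\<lambda>(x, y). (act A x, act A y)"
  have q: "distr ?d surface_measure (act A) = surface_measure"
    by (rule surface_measure_quasi_invariant[OF A])
  have qM: "distr ?M ?M ?H = ?M" by (rule offdiag_measure_invariant(2)[OF A])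
  have sf: "sigma_finite_measure ?d"
  proof (rule sigma_finite_measure_distr)
    show "sigma_finite_measure (distr ?d surface_measure (act A))"
      unfolding q by (rule sigma_finite_surface)
  qed measurable
  show "act_triple A \<in> triples \<rightarrow>\<^sub>M triples" unfolding act_triple_def by measurable
  have "triples = distr ?M ?M ?H \<Otimes>\<^sub>M distr ?d surface_measure (act A)"
    by (simp only: q qM)
  also have "\<dots> = distr (?M \<Otimes>\<^sub>M ?d) triples (act_triple A)"
    unfolding act_triple_def
    by (rule pair_measure_distr) (measurable, unfold q, rule sigma_finite_surface)
  also have "?M \<Otimes>\<^sub>M ?d = density ?M (\<lambda>_. 1) \<Otimes>\<^sub>M ?d" by (simp only: density_1)
  also have "\<dots> = density triples (\<lambda>(p, s). 1 * ?k s)"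
    by (rule pair_measure_density) (measurable, rule sigma_finite_surface, rule sf)
  finally show "distr (density triples (\<lambda>(p, s). ?k s)) triples (act_triple A) = triples" by simp
qed

section \<open>Cosets as pairs of points\<close>

text \<open>
  Since every pair of distinct points comes from a coset, the section used in the definition of \<^const>\<open>mu\<close>
  is a right inverse of \<^const>\<open>coset_pair\<close>.  Both maps are measurable, and each transports one measure to
  the other.
\<close>

context
  assumes n: "2 \<le> CARD('n::{finite,linorder})"
begin

lemma coset_pair_section:
  assumes "p \<in> space (offdiag_measure :: ('n pt \<times> 'n pt) measure)"
  shows "inv_into G_mod_H coset_pair p \<in> G_mod_H" "coset_pair (inv_into G_mod_H coset_pair p) = p"
proof -
  obtain s t where p: "p = (s, t)" by (cases p)
  have "p \<in> coset_pair ` G_mod_H" unfolding p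
    by (rule coset_pair_surj[OF n]) (use assms in \<open>simp_all add: p space_offdiag\<close>)
  then show "inv_into G_mod_H coset_pair p \<in> G_mod_H" "coset_pair (inv_into G_mod_H coset_pair p) = p"
    by (rule inv_into_into, rule f_inv_into_f)
qed

lemma inj_section: "inj_on (inv_into G_mod_H coset_pair) (space (offdiag_measure :: ('n pt \<times> 'n pt) measure))"
  by (rule inj_on_inverseI[of _ coset_pair]) (rule coset_pair_section(2))

lemma space_mu: "C \<in> space (mu :: 'n lmat set measure) \<Longrightarrow> C \<in> G_mod_H"
  by (auto simp: mu_def space_embed_measure coset_pair_section)

lemma section_measurable: "inv_into G_mod_H coset_pair \<in> (offdiag_measure :: ('n pt \<times> 'n pt) measure) \<rightarrow>\<^sub>M mu"
  unfolding mu_def by (rule measurable_embed_measure2'[OF inj_section])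

lemma coset_pair_measurable: "coset_pair \<in> mu \<rightarrow>\<^sub>M (offdiag_measure :: ('n pt \<times> 'n pt) measure)"
  unfolding mu_def
  by (rule measurable_embed_measure1, rule measurable_cong[THEN iffD2, of _ _ "\<lambda>p. p"])
    (simp_all add: coset_pair_section)

lemma mu_eq: "distr offdiag_measure mu (inv_into G_mod_H coset_pair) = (mu :: 'n lmat set measure)"
  unfolding mu_def by (rule embed_measure_eq_distr'[OF inj_section, symmetric])

lemma distr_coset_pair: "distr mu offdiag_measure coset_pair = (offdiag_measure :: ('n pt \<times> 'n pt) measure)"
proof -
  have "distr mu offdiag_measure coset_pair
      = distr (distr offdiag_measure mu (inv_into G_mod_H coset_pair)) offdiag_measure (coset_pair :: 'n lmat set \<Rightarrow> _)"
    by (simp only: mu_eq)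
  also have "\<dots> = distr offdiag_measure offdiag_measure (\<lambda>p. coset_pair (inv_into G_mod_H coset_pair p :: 'n lmat set))"
    by (subst distr_distr[OF coset_pair_measurable section_measurable]) (simp add: o_def)
  also have "\<dots> = distr offdiag_measure offdiag_measure (\<lambda>p. p)"
    by (rule distr_cong) (simp_all add: coset_pair_section)
  finally show ?thesis by (simp add: distr_id)
qed

lemma sigma_finite_mu: "sigma_finite_measure (mu :: 'n lmat set measure)"
  by (rule sigma_finite_measure_distr[OF _ coset_pair_measurable])
    (unfold distr_coset_pair, rule sigma_finite_offdiag)

text \<open>
  The integrability statement includes measurability, in both directions; this is why the maps in both
  directions are needed.
\<close>

lemma transport_to_triples:
  fixes F :: "'n lmat set \<times> 'n pt \<Rightarrow> complex" and G :: "('n pt \<times> 'n pt) \<times> 'n pt \<Rightarrow> complex"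
  assumes FG: "\<And>C s. C \<in> G_mod_H \<Longrightarrow> norm s = 1 \<Longrightarrow> F (C, s) = G (coset_pair C, s)"
  shows "integrable (mu \<Otimes>\<^sub>M surface_measure) F \<longleftrightarrow> integrable triples G"
    and "integrable triples G \<Longrightarrow> (LINT x|(mu \<Otimes>\<^sub>M surface_measure). F x) = (LINT x|triples. G x)"
proof -
  note [measurable] = coset_pair_measurable section_measurable
  let ?\<sigma> = "surface_measure :: 'n pt measure"
  let ?s = "inv_into G_mod_H coset_pair :: 'n pt \<times> 'n pt \<Rightarrow> 'n lmat set"
  have id: "distr ?\<sigma> ?\<sigma> (\<lambda>s. s) = ?\<sigma>" by (rule distr_id)
  have sf: "sigma_finite_measure (distr ?\<sigma> ?\<sigma> (\<lambda>s. s))" unfolding id by (rule sigma_finite_surface)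
  have fwd: "distr (mu \<Otimes>\<^sub>M ?\<sigma>) triples (\<lambda>(C, s). (coset_pair C, s)) = triples"
    using pair_measure_distr[OF coset_pair_measurable measurable_ident_sets[OF refl] sf]
    by (simp only: distr_coset_pair id)
  have bwd: "distr triples (mu \<Otimes>\<^sub>M ?\<sigma>) (\<lambda>(p, s). (?s p, s)) = mu \<Otimes>\<^sub>M ?\<sigma>"
    using pair_measure_distr[OF section_measurable measurable_ident_sets[OF refl] sf]
    by (simp only: mu_eq id)
  have mto: "(\<lambda>(C, s). (coset_pair C, s)) \<in> mu \<Otimes>\<^sub>M ?\<sigma> \<rightarrow>\<^sub>M triples" by measurable
  have mfrom: "(\<lambda>(p, s). (?s p, s)) \<in> triples \<rightarrow>\<^sub>M mu \<Otimes>\<^sub>M ?\<sigma>" by measurable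
  have F: "F z = G (case z of (C, s) \<Rightarrow> (coset_pair C, s))" if "z \<in> space (mu \<Otimes>\<^sub>M ?\<sigma>)" for z
    using that by (auto simp: space_pair_measure intro!: FG space_mu)
  have G: "G z = F (case z of (p, s) \<Rightarrow> (?s p, s))" if "z \<in> space triples" for z
    using that by (auto simp: space_pair_measure coset_pair_section FG)
  show iff: "integrable (mu \<Otimes>\<^sub>M ?\<sigma>) F \<longleftrightarrow> integrable triples G"
  proof
    assume "integrable (mu \<Otimes>\<^sub>M ?\<sigma>) F"
    then have "integrable (distr triples (mu \<Otimes>\<^sub>M ?\<sigma>) (\<lambda>(p, s). (?s p, s))) F" by (simp only: bwd)
    from integrable_distr[OF mfrom this] show "integrable triples G"
      by (rule Bochner_Integration.integrable_cong[THEN iffD1, rotated 2]) (simp_all add: G)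
  next
    assume "integrable triples G"
    then have "integrable (distr (mu \<Otimes>\<^sub>M ?\<sigma>) triples (\<lambda>(C, s). (coset_pair C, s))) G" by (simp only: fwd)
    from integrable_distr[OF mto this] show "integrable (mu \<Otimes>\<^sub>M ?\<sigma>) F"
      by (rule Bochner_Integration.integrable_cong[THEN iffD1, rotated 2]) (simp_all add: F)
  qed
  assume int: "integrable triples G"
  have "(LINT x|triples. G x) = (LINT x|(distr (mu \<Otimes>\<^sub>M ?\<sigma>) triples (\<lambda>(C, s). (coset_pair C, s))). G x)"
    by (simp only: fwd)
  also have "\<dots> = (LINT z|(mu \<Otimes>\<^sub>M ?\<sigma>). G (case z of (C, s) \<Rightarrow> (coset_pair C, s)))"
    by (rule integral_distr[OF mto]) (use int in auto)
  also have "\<dots> = (LINT z|(mu \<Otimes>\<^sub>M ?\<sigma>). F z)"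
    by (rule Bochner_Integration.integral_cong) (simp_all add: F)
  finally show "(LINT x|(mu \<Otimes>\<^sub>M ?\<sigma>). F x) = (LINT x|triples. G x)" ..
qed

end

section \<open>The kernel and its invariance\<close>

lemma powr_of_real_inverse:
  assumes "0 < c"
  shows "complex_of_real (inverse c) powr z = complex_of_real c powr (- z)"
  using assms by (simp add: powr_def Ln_of_real ln_inverse del: of_real_inverse)

lemma powr_of_real_mult:
  assumes "0 \<le> a" "0 \<le> b"
  shows "complex_of_real (a * b) powr z = complex_of_real a powr z * complex_of_real b powr z"
  unfolding of_real_mult using assms by (intro powr_times_real) auto

lemma powr_of_real_sqrt:
  assumes "0 < c"
  shows "complex_of_real (sqrt c) powr z = complex_of_real c powr (z / 2)"
  using assms by (simp add: powr_def Ln_of_real ln_sqrt field_simps)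

lemma powr_three_sqrt:
  assumes "0 < a" "0 < b" "0 < c"
  shows "complex_of_real (sqrt (a * b)) powr u * complex_of_real (sqrt (a * c)) powr v * complex_of_real (sqrt (b * c)) powr w
    = complex_of_real a powr ((u + v) / 2) * complex_of_real b powr ((u + w) / 2) * complex_of_real c powr ((v + w) / 2)"
  using assms by (simp add: powr_of_real_sqrt powr_of_real_mult powr_add add_divide_distrib del: of_real_mult)

definition trilinear_kernel :: "complex \<Rightarrow> complex \<Rightarrow> complex \<Rightarrow> ('n::finite pt \<times> 'n pt) \<times> 'n pt \<Rightarrow> complex" where
  "trilinear_kernel l1 l2 l3 = (\<lambda>((x, y), s).
     complex_of_real (norm (x - y) / 2) powr (3 * complex_of_real (rho TYPE('n)) + l1 + l2 - l3)
     * complex_of_real (norm (x - s)) powr (- complex_of_real (rho TYPE('n)) + l3 + l1 - l2)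
     * complex_of_real (norm (y - s)) powr (- complex_of_real (rho TYPE('n)) + l3 - l1 + l2))"

text \<open>
  The three exponents \<open>u, v, w\<close> of the kernel are determined by the requirement that \<open>(u+v)/2\<close>, \<open>(u+w)/2\<close>
  and \<open>(v+w)/2\<close> be \<open>\<rho> + \<lambda>\<^sub>1\<close>, \<open>\<rho> + \<lambda>\<^sub>2\<close> and \<open>-\<rho> + \<lambda>\<^sub>3\<close>.
\<close>

lemma trilinear_kernel_scale:
  fixes x y s x' y' s' :: "'n::finite pt"
  assumes "0 < a" "0 < b" "0 < c"
    and "norm (x' - y') = sqrt (a * b) * norm (x - y)"
    and "norm (x' - s') = sqrt (a * c) * norm (x - s)"
    and "norm (y' - s') = sqrt (b * c) * norm (y - s)"
  shows "trilinear_kernel l1 l2 l3 ((x', y'), s') =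
    complex_of_real a powr (complex_of_real (rho TYPE('n)) + l1)
    * complex_of_real b powr (complex_of_real (rho TYPE('n)) + l2)
    * complex_of_real c powr (- complex_of_real (rho TYPE('n)) + l3)
    * trilinear_kernel l1 l2 l3 ((x, y), s)"
proof -
  let ?r = "complex_of_real (rho TYPE('n))"
  let ?u = "3 * ?r + l1 + l2 - l3" and ?v = "- ?r + l3 + l1 - l2" and ?w = "- ?r + l3 - l1 + l2"
  have e: "(?u + ?v) / 2 = ?r + l1" "(?u + ?w) / 2 = ?r + l2" "(?v + ?w) / 2 = - ?r + l3"
    by (simp_all add: field_simps)
  have d: "norm (x' - y') / 2 = sqrt (a * b) * (norm (x - y) / 2)" using assms(4) by simp
  have "trilinear_kernel l1 l2 l3 ((x', y'), s') =
     (complex_of_real (sqrt (a * b)) powr ?u * complex_of_real (sqrt (a * c)) powr ?v * complex_of_real (sqrt (b * c)) powr ?w)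
     * trilinear_kernel l1 l2 l3 ((x, y), s)"
    unfolding trilinear_kernel_def split d assms(5,6)
    using assms(1-3) by (subst (1 2 3) powr_of_real_mult) (simp_all add: mult_ac)
  then show ?thesis unfolding powr_three_sqrt[OF assms(1-3)] e .
qed

lemma norm_diff_act_sqrt:
  assumes "A \<in> orthochronous" "norm x = 1" "norm y = 1"
  shows "norm (act A x - act A y) = sqrt (kappa A x * kappa A y) * norm (x - y)"
  using norm_diff_act[OF assms] kappa_pos[OF assms(1,2)] kappa_pos[OF assms(1,3)]
  by (metis norm_ge_zero real_sqrt_mult real_sqrt_unique)

text \<open>
  Apply the scaling rule to \<open>g\<close> and the points \<open>1\<^sup>+\<close>, \<open>1\<^sup>-\<close> and \<open>s' = g\<^sup>-\<^sup>1(s)\<close>.  As \<open>1\<^sup>+\<close> and \<open>1\<^sup>-\<close> have distance 2,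
  the kernel at these points is \<open>\<Theta>(s')\<close>.  The result depends on \<open>g\<close> only through the pair of points,
  so that the representative of the coset does not matter.
\<close>

lemma integrand_eq_kernel:
  fixes f1 f2 f3 :: "'n::{finite,linorder} pt \<Rightarrow> complex"
  assumes C: "C \<in> G_mod_H" and s: "norm s = 1"
  shows "F_integrand (- l3) (l1 - l2) (P_op l1 l2 (tensor f1 f2)) C s * f3 s
    = (\<lambda>((x, y), s). trilinear_kernel l1 l2 l3 ((x, y), s) * (f1 x * f2 y * f3 s)) (coset_pair C, s)"
proof -
  define g where "g = coset_rep C"
  have g: "g \<in> SO1_0" unfolding g_def by (rule coset_rep_in[OF C])
  have gi: "matrix_inv g \<in> SO1_0" by (rule SO1_0_inv[OF g])
  note go = SO1_0_orthochronous[OF g] and gio = SO1_0_orthochronous[OF gi]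
  have inv: "g ** matrix_inv g = mat 1"
    using det_SO1[OF SO1_0_imp_SO1[OF g]] by (intro matrix_inv_mult) simp
  define s' where "s' = act (matrix_inv g) s"
  have s': "norm s' = 1" unfolding s'_def by (rule norm_act[OF gio s])
  have gs: "act g s' = s"
    unfolding s'_def act_mult[OF go gio s, symmetric] inv by (rule act_one[OF s])
  have ks: "kappa (matrix_inv g) s = inverse (kappa g s')"
    using kappa_mult[OF go gio s] kappa_one[OF s] kappa_pos[OF go s'] by (simp add: inv s'_def[symmetric] field_simps)
  let ?p = "one_plus :: 'n pt" and ?m = "one_minus :: 'n pt" and ?r = "complex_of_real (rho TYPE('n))"
  define a b c where "a = kappa g ?p" and "b = kappa g ?m" and "c = kappa g s'"
  have pos: "0 < a" "0 < b" "0 < c"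
    unfolding a_def b_def c_def using kappa_pos[OF go] s' by auto
  \<comment> \<open>This is the reason for the factor 1/2 in the kernel.\<close>
  have pm: "norm (?p - ?m) / 2 = 1"
  proof -
    have "?p - ?m = 2 *\<^sub>R ?p" by (simp add: one_minus_eq scaleR_2)
    then show ?thesis by simp
  qed
  have k0: "trilinear_kernel l1 l2 l3 ((?p, ?m), s')
     = complex_of_real (norm (?p - s')) powr (- ?r + l3 + l1 - l2) * complex_of_real (norm (?m - s')) powr (- ?r + l3 - l1 + l2)"
    unfolding trilinear_kernel_def split pm by simp
  have "trilinear_kernel l1 l2 l3 ((act g ?p, act g ?m), act g s')
    = complex_of_real a powr (?r + l1) * complex_of_real b powr (?r + l2) * complex_of_real c powr (- ?r + l3)
      * trilinear_kernel l1 l2 l3 ((?p, ?m), s')"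
    unfolding a_def b_def c_def
    by (rule trilinear_kernel_scale) (use pos s' in \<open>auto simp: a_def b_def c_def norm_diff_act_sqrt[OF go]\<close>)
  then show ?thesis
    unfolding F_integrand_def P_op_def pi_rep_def Theta_def tensor_def coset_pair_def g_def[symmetric] split
      s'_def[symmetric] ks gs k0 a_def[symmetric] b_def[symmetric] c_def[symmetric] powr_of_real_inverse[OF pos(3)]
    by (simp add: algebra_simps)
qed

text \<open>
  The scaling rule yields \<open>\<kappa>(h,s)\<close> to the power \<open>-\<rho> + \<lambda>\<^sub>3\<close>, while \<open>\<pi>(g)f\<^sub>3\<close> contains the power \<open>\<rho> + \<lambda>\<^sub>3\<close>; the
  quotient is the Jacobian, as \<open>2\<rho> = n - 1\<close>.
\<close>

lemma kernel_pi_rep: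
  fixes f1 f2 f3 :: "'n::{finite,linorder} pt \<Rightarrow> complex"
  assumes g: "matrix_inv g \<in> orthochronous" and "norm x = 1" "norm y = 1" "norm s = 1"
  shows "(\<lambda>((x, y), s). trilinear_kernel l1 l2 l3 ((x, y), s) * (pi_rep l1 g f1 x * pi_rep l2 g f2 y * pi_rep l3 g f3 s)) ((x, y), s)
    = (kappa (matrix_inv g) s ^ (CARD('n) - 1)) *\<^sub>R
      (\<lambda>((x, y), s). trilinear_kernel l1 l2 l3 ((x, y), s) * (f1 x * f2 y * f3 s)) (act_triple (matrix_inv g) ((x, y), s))"
proof -
  define h where "h = matrix_inv g"
  let ?r = "complex_of_real (rho TYPE('n))"
  note ho = g[folded h_def]
  define a b c where "a = kappa h x" and "b = kappa h y" and "c = kappa h s"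
  have pos: "0 < a" "0 < b" "0 < c"
    unfolding a_def b_def c_def using kappa_pos[OF ho] assms by auto
  have k: "trilinear_kernel l1 l2 l3 ((act h x, act h y), act h s)
    = complex_of_real a powr (?r + l1) * complex_of_real b powr (?r + l2) * complex_of_real c powr (- ?r + l3)
      * trilinear_kernel l1 l2 l3 ((x, y), s)"
    unfolding a_def b_def c_def
    by (rule trilinear_kernel_scale) (use pos assms in \<open>auto simp: a_def b_def c_def norm_diff_act_sqrt[OF ho]\<close>)
  have "complex_of_real (c ^ (CARD('n) - 1)) = complex_of_real c powr (of_nat (CARD('n) - 1))"
    unfolding of_real_power using pos(3) by (intro powr_nat'[symmetric]) simp
  also have "of_nat (CARD('n) - 1) = 2 * ?r"
    by (simp add: rho_def of_nat_diff)
  finally have cn: "complex_of_real (c ^ (CARD('n) - 1)) = complex_of_real c powr (2 * ?r)" .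
  have "complex_of_real c powr (2 * ?r) * complex_of_real c powr (- ?r + l3) = complex_of_real c powr (?r + l3)"
    by (simp add: powr_add[symmetric])
  then show ?thesis
    unfolding h_def[symmetric] act_triple_def split k scaleR_conv_of_real pi_rep_def
      a_def[symmetric] b_def[symmetric] c_def[symmetric] cn
    by (simp add: mult_ac)
qed

text \<open>
  Both forms are integrals over triples of points, and the map \<open>h = g\<^sup>-\<^sup>1\<close> substitutes one integrand for the
  other.
\<close>

theorem theorem4p1:
  fixes f1 f2 f3 :: "'n::{finite,linorder} pt \<Rightarrow> complex"
    and l1 l2 l3 :: complex
    and g :: "'n lmat"
  assumes "CARD('n) \<ge> 3"
    and "smooth_on_sphere f1" and "smooth_on_sphere f2" and "smooth_on_sphere f3"
    and "g \<in> SO1_0"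
    and "T_well_defined l1 l2 l3 f1 f2 f3"
  shows "T_well_defined l1 l2 l3 (pi_rep l1 g f1) (pi_rep l2 g f2) (pi_rep l3 g f3) \<and>
         T_form l1 l2 l3 (pi_rep l1 g f1) (pi_rep l2 g f2) (pi_rep l3 g f3)
           = T_form l1 l2 l3 f1 f2 f3"
proof -
  have n: "2 \<le> CARD('n)" using assms(1) by simp
  let ?\<sigma> = "surface_measure :: 'n pt measure"
  interpret mu: sigma_finite_measure "mu :: 'n lmat set measure" by (rule sigma_finite_mu[OF n])
  interpret \<sigma>: sigma_finite_measure ?\<sigma> by (rule sigma_finite_surface)
  interpret pair_sigma_finite "mu :: 'n lmat set measure" ?\<sigma> ..
  define K where "K f1 f2 f3 = (\<lambda>((x, y), s). trilinear_kernel l1 l2 l3 ((x, y), s) * (f1 x * f2 y * f3 s))"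
    for f1 f2 f3 :: "'n pt \<Rightarrow> complex"
  define F where "F f1 f2 f3 = (\<lambda>(C, s). F_integrand (- l3) (l1 - l2) (P_op l1 l2 (tensor f1 f2)) C s * f3 s)"
    for f1 f2 f3 :: "'n pt \<Rightarrow> complex"
  have FK: "F f1 f2 f3 (C, s) = K f1 f2 f3 (coset_pair C, s)" if "C \<in> G_mod_H" "norm s = 1"
    for C s and f1 f2 f3 :: "'n pt \<Rightarrow> complex"
    unfolding K_def F_def using integrand_eq_kernel[OF that] by simp
  have FK_int: "integrable (mu \<Otimes>\<^sub>M ?\<sigma>) (F f1 f2 f3) \<longleftrightarrow> integrable triples (K f1 f2 f3)"
    for f1 f2 f3 :: "'n pt \<Rightarrow> complex"
    by (rule transport_to_triples(1)[OF n]) (rule FK)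
  have well: "T_well_defined l1 l2 l3 f1 f2 f3 \<longleftrightarrow> integrable triples (K f1 f2 f3)"
    for f1 f2 f3 :: "'n pt \<Rightarrow> complex"
    unfolding T_well_defined_def FK_int[symmetric] F_def ..
  have form: "T_form l1 l2 l3 f1 f2 f3 = (LINT z|triples. K f1 f2 f3 z)"
    if int: "integrable triples (K f1 f2 f3)" for f1 f2 f3 :: "'n pt \<Rightarrow> complex"
  proof -
    have "T_form l1 l2 l3 f1 f2 f3
        = (LINT s|?\<sigma>. (LINT C|mu. F_integrand (- l3) (l1 - l2) (P_op l1 l2 (tensor f1 f2)) C s * f3 s))"
      unfolding T_form_def pairing_def F_op_def by (simp only: integral_mult_left_zero)
    also have "\<dots> = (LINT z|(mu \<Otimes>\<^sub>M ?\<sigma>). F f1 f2 f3 z)"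
      unfolding F_def by (rule integral_snd) (use int in \<open>simp only: FK_int[symmetric] F_def\<close>)
    also have "\<dots> = (LINT z|triples. K f1 f2 f3 z)"
      by (rule transport_to_triples(2)[OF n _ int]) (rule FK)
    finally show ?thesis .
  qed
  define h where "h = matrix_inv g"
  have h: "h \<in> orthochronous" unfolding h_def by (intro SO1_0_orthochronous SO1_0_inv assms(5))
  let ?j = "\<lambda>z :: ('n pt \<times> 'n pt) \<times> 'n pt. kappa h (snd z) ^ (CARD('n) - 1)"
  let ?K = "K f1 f2 f3" and ?K' = "K (pi_rep l1 g f1) (pi_rep l2 g f2) (pi_rep l3 g f3)"
  have K': "?K' z = ?j z *\<^sub>R ?K (act_triple h z)" if z: "z \<in> space triples" for z
  proof -
    obtain x y s where "z = ((x, y), s)" by (metis prod.exhaust)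
    with z show ?thesis
      using kernel_pi_rep[of g x y s l1 l2 l3 f1 f2 f3] h
      by (simp add: K_def h_def space_pair_measure space_offdiag)
  qed
  note Am = triples_quasi_invariant(1)[OF h]
  have Aq: "distr (density triples (\<lambda>z. ennreal (?j z))) triples (act_triple h) = triples"
    using triples_quasi_invariant(2)[OF h] by (simp add: split_beta')
  have Am': "act_triple h \<in> density triples (\<lambda>z. ennreal (?j z)) \<rightarrow>\<^sub>M triples"
    using Am by simp
  have j: "?j \<in> borel_measurable triples"
    using measurable_compose[OF measurable_snd kappa_measurable[OF h]] by measurable
  have j0: "AE z in triples. 0 \<le> ?j z"
    by (rule AE_I2) (auto simp: space_pair_measure less_imp_le[OF kappa_pos[OF h]])
  have int: "integrable triples ?K" using assms(6) by (simp only: well)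
  then have Km: "?K \<in> borel_measurable triples" by (rule borel_measurable_integrable)
  have KAm: "(\<lambda>z. ?K (act_triple h z)) \<in> borel_measurable triples" by (rule measurable_compose[OF Am Km])
  have "integrable (distr (density triples (\<lambda>z. ennreal (?j z))) triples (act_triple h)) ?K"
    using int by (simp only: Aq)
  from integrable_distr[OF Am' this] have "integrable triples (\<lambda>z. ?j z *\<^sub>R ?K (act_triple h z))"
    by (simp only: integrable_density[OF KAm j j0])
  then have int': "integrable triples ?K'"
    by (rule Bochner_Integration.integrable_cong[THEN iffD1, rotated 2]) (simp_all only: K')
  have "(LINT z|triples. ?K z) = (LINT z|(distr (density triples (\<lambda>z. ennreal (?j z))) triples (act_triple h)). ?K z)"
    by (simp only: Aq)
  also have "\<dots> = (LINT z|(density triples (\<lambda>z. ennreal (?j z))). ?K (act_triple h z))"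
    by (rule integral_distr[OF Am' Km])
  also have "\<dots> = (LINT z|triples. ?j z *\<^sub>R ?K (act_triple h z))"
    by (rule integral_density[OF KAm j j0])
  also have "\<dots> = (LINT z|triples. ?K' z)"
    by (rule Bochner_Integration.integral_cong) (simp_all only: K')
  finally show ?thesis by (simp only: well form[OF int] form[OF int'] int')
qed

end
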